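(* Let $\mathcal R$ be a left-linear TRS such that its duplicating rules $\mathcal R_{\mathsf d}$ terminate relative to its non-duplicating rules $\mathcal R_{\mathsf{nd}}$. Suppose there is an index mapping $i\colon\mathcal R\to\mathbb N$ such that every critical peak of $\mathcal R$ has a local diagram that has the fan property and is decreasing for the rule labeling $\ell^i$ (with labels compared by $>_{\mathbb N}$ and $\geqslant_{\mathbb N}$). Then $\mathcal R$ is confluent.
   Context: Terms over a signature and variables $\mathcal V$; $\mathcal{F}\mathrm{Pos}(t)$ is the set of positions $p$ of $t$ with $t|_p\notin\mathcal V$; $s[t]_p$ is replacement at position $p$. A TRS is a set of rules $l\to r$ (no variable conditions imposed); it is left-linear if no variable occurs more than once in any left-hand side; it is confluent if ${}^*\!\leftarrow\cdot\to^*\subseteq\to^*\cdot{}^*\!\leftarrow$. A rule $l\to r$ is duplicating if $|l|_x<|r|_x$ for some variable $x$ ($|t|_x$ = number of occurrences of $x$ in $t$); $\mathcal R_{\mathsf d}$ and $\mathcal R_{\mathsf{nd}}$ are the duplicating and non-duplicating rules of $\mathcal R$. $\mathcal R_{\mathsf d}$ terminates relative to $\mathcal R_{\mathsf{nd}}$ if $\to^*_{\mathcal R_{\mathsf{nd}}}\cdot\to_{\mathcal R_{\mathsf d}}\cdot\to^*_{\mathcal R_{\mathsf{nd}}}$ is well-founded. A rewrite step $s\to^\pi t$ with $\pi=\langle p,l\to r,\sigma\rangle$ means $l\to r\in\mathcal R$, $s|_p=l\sigma$, $t=s[r\sigma]_p$; $t\leftarrow^\pi s$ is its inverse. The rule labeling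 assigns to a step (forward or backward) using rule $l\to r$ the label $i(l\to r)$. A critical overlap $(l_1\to r_1,p,l_2\to r_2)_\mu$ consists of variants of rules of $\mathcal R$ without common variables, a position $p\in\mathcal{F}\mathrm{Pos}(l_2)$ and a most general unifier $\mu$ of $l_1$ and $l_2|_p$ (root overlaps of a rule with a variant of itself are not excluded); it yields the critical peak $t\leftarrow s\to u$ with $s=l_2\mu$, $t=l_2\mu[r_1\mu]_p$ (step using $l_1\to r_1$, label $\alpha=i(l_1\to r_1)$) and $u=r_2\mu$ (step using $l_2\to r_2$, label $\beta=i(l_2\to r_2)$). A local diagram for this peak is a conversion $t\leftrightarrow^*t'\to^=t''\leftrightarrow^*u''\leftarrow^=u'\leftrightarrow^*u$; it is decreasing for $\ell^i$ if every step of $t\leftrightarrow^*t'$ has label $<\alpha$, the step $t'\to^=t''$ (if present) has label $\leqslant\beta$, every step of $t''\leftrightarrow^*u''$ has label $<\alpha$ or $<\beta$, the step $u''\leftarrow^=u'$ (if present) has label $\leqslant\alpha$, and every step of $u'\leftrightarrow^*u$ has label $<\beta$. Writing the whole conversion of the local diagram as $t=t_1\leftrightarrow t_2\leftrightarrow\cdots\leftrightarrow t_n=u$, the diagram has the fan property if $s\to^*_{\mathcal R}t_j$ for all $1\leqslant j\leqslant n$. *)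

theory Defs
  imports "HOL-Library.Confluence"
begin

text \<open>
  A signature is a set of pairs of function symbols and arities. Terms are raw; the terms over a
  signature F are those satisfying \<open>wf_term F\<close>, and rewriting is restricted to them.
\<close>

datatype ('f, vars: 'v) fterm = Var 'v | Fun 'f "('f, 'v) fterm list"

type_synonym ('f, 'v) subst = "'v \<Rightarrow> ('f, 'v) fterm"
type_synonym ('f, 'v) rule = "('f, 'v) fterm \<times> ('f, 'v) fterm"
type_synonym ('f, 'v) trs = "('f, 'v) rule set"
type_synonym pos = "nat list"

fun wf_term :: "('f \<times> nat) set \<Rightarrow> ('f, 'v) fterm \<Rightarrow> bool" where
  "wf_term F (Var x) \<longleftrightarrow> True"
| "wf_term F (Fun f ts) \<longleftrightarrow> (f, length ts) \<in> F \<and> (\<forall>t \<in> set ts. wf_term F t)"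

fun subst :: "('f, 'v) fterm \<Rightarrow> ('f, 'v) subst \<Rightarrow> ('f, 'v) fterm"  (infixl "\<cdot>" 67) where
  "Var x \<cdot> \<sigma> = \<sigma> x"
| "Fun f ts \<cdot> \<sigma> = Fun f (map (\<lambda>t. t \<cdot> \<sigma>) ts)"

fun occs :: "'v \<Rightarrow> ('f, 'v) fterm \<Rightarrow> nat" where
  "occs x (Var y) = (if x = y then 1 else 0)"
| "occs x (Fun f ts) = sum_list (map (occs x) ts)"

lemma size_nth_fterm [termination_simp]:
  "k < length ts \<Longrightarrow> size (ts ! k) < Suc (size_list size ts)"
  by (auto simp: less_Suc_eq_le intro: size_list_estimation'[OF nth_mem])

fun poss :: "('f, 'v) fterm \<Rightarrow> pos set" where
  "poss (Var x) = {[]}"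
| "poss (Fun f ts) = insert [] (\<Union>k \<in> {..<length ts}. (#) k ` poss (ts ! k))"

text \<open>The following two functions are meaningful only for positions of the given term.\<close>

fun subt_at :: "('f, 'v) fterm \<Rightarrow> pos \<Rightarrow> ('f, 'v) fterm" where
  "subt_at t [] = t"
| "subt_at (Fun f ts) (k # p) = subt_at (ts ! k) p"
| "subt_at (Var x) (k # p) = Var x"

fun replace_at :: "('f, 'v) fterm \<Rightarrow> pos \<Rightarrow> ('f, 'v) fterm \<Rightarrow> ('f, 'v) fterm" where
  "replace_at s [] t = t"
| "replace_at (Fun f ts) (k # p) t = Fun f (ts[k := replace_at (ts ! k) p t])"
| "replace_at (Var x) (k # p) t = Var x"

definition fposs :: "('f, 'v) fterm \<Rightarrow> pos set" where
  "fposs t = {p \<in> poss t. subt_at t p \<notin> range Var}"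

definition trs_over :: "('f \<times> nat) set \<Rightarrow> ('f, 'v) trs \<Rightarrow> bool" where
  "trs_over F R \<longleftrightarrow> (\<forall>(l, r) \<in> R. wf_term F l \<and> wf_term F r)"

definition left_linear :: "('f, 'v) trs \<Rightarrow> bool" where
  "left_linear R \<longleftrightarrow> (\<forall>(l, r) \<in> R. \<forall>x. occs x l \<le> 1)"

definition duplicating :: "('f, 'v) rule \<Rightarrow> bool" where
  "duplicating e \<longleftrightarrow> (\<exists>x. occs x (fst e) < occs x (snd e))"

definition dup_rules :: "('f, 'v) trs \<Rightarrow> ('f, 'v) trs" where
  "dup_rules R = {e \<in> R. duplicating e}"

definition nondup_rules :: "('f, 'v) trs \<Rightarrow> ('f, 'v) trs" where
  "nondup_rules R = {e \<in> R. \<not> duplicating e}"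


subsection \<open>Rewriting\<close>

type_synonym ('f, 'v) redex = "pos \<times> ('f, 'v) rule \<times> ('f, 'v) subst"

definition step_by ::
  "('f \<times> nat) set \<Rightarrow> ('f, 'v) trs \<Rightarrow> ('f, 'v) redex \<Rightarrow> ('f, 'v) fterm \<Rightarrow> ('f, 'v) fterm \<Rightarrow> bool"
where
  "step_by F R \<pi> s t \<longleftrightarrow> wf_term F s \<and> wf_term F t \<and>
     (case \<pi> of (p, (l, r), \<sigma>) \<Rightarrow>
        (l, r) \<in> R \<and> p \<in> poss s \<and> subt_at s p = l \<cdot> \<sigma> \<and> t = replace_at s p (r \<cdot> \<sigma>))"

definition rstep ::
  "('f \<times> nat) set \<Rightarrow> ('f, 'v) trs \<Rightarrow> ('f, 'v) fterm \<Rightarrow> ('f, 'v) fterm \<Rightarrow> bool" where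
  "rstep F R s t \<longleftrightarrow> (\<exists>\<pi>. step_by F R \<pi> s t)"

definition rel_terminating ::
  "('f \<times> nat) set \<Rightarrow> ('f, 'v) trs \<Rightarrow> ('f, 'v) trs \<Rightarrow> bool" where
  "rel_terminating F R S \<longleftrightarrow>
     wfp (((rstep F S)\<^sup>*\<^sup>* OO rstep F R OO (rstep F S)\<^sup>*\<^sup>*)\<inverse>\<inverse>)"

definition rule_label :: "(('f, 'v) rule \<Rightarrow> nat) \<Rightarrow> ('f, 'v) redex \<Rightarrow> nat" where
  "rule_label i \<pi> = i (fst (snd \<pi>))"

text \<open>
  The list in a conversion records, for each step, the contracted redex and the term on the
  right of the step. So the terms of a conversion from s are s and the second components.
\<close>

type_synonym ('f, 'v) steps = "(('f, 'v) redex \<times> ('f, 'v) fterm) list"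

inductive conversion ::
  "('f \<times> nat) set \<Rightarrow> ('f, 'v) trs \<Rightarrow> ('f, 'v) fterm \<Rightarrow> ('f, 'v) steps \<Rightarrow> ('f, 'v) fterm \<Rightarrow> bool"
  for F R where
  conv_nil: "conversion F R s [] s"
| conv_forward: "step_by F R \<pi> s t \<Longrightarrow> conversion F R t c u \<Longrightarrow> conversion F R s ((\<pi>, t) # c) u"
| conv_backward: "step_by F R \<pi> t s \<Longrightarrow> conversion F R t c u \<Longrightarrow> conversion F R s ((\<pi>, t) # c) u"

definition opt_forward ::
  "('f \<times> nat) set \<Rightarrow> ('f, 'v) trs \<Rightarrow> ('f, 'v) fterm \<Rightarrow> ('f, 'v) steps \<Rightarrow> ('f, 'v) fterm \<Rightarrow> bool"
where
  "opt_forward F R s c t \<longleftrightarrow> c = [] \<and> s = t \<or> (\<exists>\<pi>. c = [(\<pi>, t)] \<and> step_by F R \<pi> s t)"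

definition opt_backward ::
  "('f \<times> nat) set \<Rightarrow> ('f, 'v) trs \<Rightarrow> ('f, 'v) fterm \<Rightarrow> ('f, 'v) steps \<Rightarrow> ('f, 'v) fterm \<Rightarrow> bool"
where
  "opt_backward F R s c t \<longleftrightarrow> c = [] \<and> s = t \<or> (\<exists>\<pi>. c = [(\<pi>, t)] \<and> step_by F R \<pi> t s)"


subsection \<open>Critical peaks\<close>

definition rename_rule :: "('v \<Rightarrow> 'v) \<Rightarrow> ('f, 'v) rule \<Rightarrow> ('f, 'v) rule" where
  "rename_rule \<rho> e = (fst e \<cdot> (Var \<circ> \<rho>), snd e \<cdot> (Var \<circ> \<rho>))"

definition variant_of :: "('f, 'v) rule \<Rightarrow> ('f, 'v) rule \<Rightarrow> bool" where
  "variant_of e' e \<longleftrightarrow> (\<exists>\<rho>. bij \<rho> \<and> e' = rename_rule \<rho> e)"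

definition vars_rule :: "('f, 'v) rule \<Rightarrow> 'v set" where
  "vars_rule e = vars (fst e) \<union> vars (snd e)"

definition is_mgu :: "('f, 'v) subst \<Rightarrow> ('f, 'v) fterm \<Rightarrow> ('f, 'v) fterm \<Rightarrow> bool" where
  "is_mgu \<mu> s t \<longleftrightarrow> s \<cdot> \<mu> = t \<cdot> \<mu> \<and> (\<forall>\<tau>. s \<cdot> \<tau> = t \<cdot> \<tau> \<longrightarrow> (\<exists>\<delta>. \<forall>x. \<tau> x = \<mu> x \<cdot> \<delta>))"

definition critical_overlap ::
  "('f, 'v) rule \<Rightarrow> pos \<Rightarrow> ('f, 'v) rule \<Rightarrow> ('f, 'v) subst \<Rightarrow> bool" where
  "critical_overlap e\<^sub>1 p e\<^sub>2 \<mu> \<longleftrightarrow>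
     vars_rule e\<^sub>1 \<inter> vars_rule e\<^sub>2 = {} \<and> p \<in> fposs (fst e\<^sub>2) \<and>
     is_mgu \<mu> (fst e\<^sub>1) (subt_at (fst e\<^sub>2) p)"

text \<open>
  The peak t <- s -> u, where the variants used in the overlap stem from the rules
  \<open>e\<^sub>1\<close> (left step) and \<open>e\<^sub>2\<close> (right step) of R. These are kept as
  parameters because the labels of the two steps are the indices of \<open>e\<^sub>1\<close> and \<open>e\<^sub>2\<close>.
\<close>

definition critical_peak ::
  "('f, 'v) trs \<Rightarrow> ('f, 'v) rule \<Rightarrow> ('f, 'v) rule \<Rightarrow>
   ('f, 'v) fterm \<Rightarrow> ('f, 'v) fterm \<Rightarrow> ('f, 'v) fterm \<Rightarrow> bool" where
  "critical_peak R e\<^sub>1 e\<^sub>2 t s u \<longleftrightarrow> e\<^sub>1 \<in> R \<and> e\<^sub>2 \<in> R \<and>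
     (\<exists>l\<^sub>1 r\<^sub>1 l\<^sub>2 r\<^sub>2 p \<mu>. variant_of (l\<^sub>1, r\<^sub>1) e\<^sub>1 \<and> variant_of (l\<^sub>2, r\<^sub>2) e\<^sub>2 \<and>
        critical_overlap (l\<^sub>1, r\<^sub>1) p (l\<^sub>2, r\<^sub>2) \<mu> \<and>
        s = l\<^sub>2 \<cdot> \<mu> \<and> t = replace_at (l\<^sub>2 \<cdot> \<mu>) p (r\<^sub>1 \<cdot> \<mu>) \<and> u = r\<^sub>2 \<cdot> \<mu>)"


subsection \<open>Local diagrams\<close>

text \<open>The five segments of the conversion that closes a local peak.\<close>

type_synonym ('f, 'v) diagram =
  "('f, 'v) steps \<times> ('f, 'v) steps \<times> ('f, 'v) steps \<times> ('f, 'v) steps \<times> ('f, 'v) steps"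

definition local_diagram ::
  "('f \<times> nat) set \<Rightarrow> ('f, 'v) trs \<Rightarrow> ('f, 'v) fterm \<Rightarrow> ('f, 'v) diagram \<Rightarrow> ('f, 'v) fterm \<Rightarrow> bool"
where
  "local_diagram F R t D u \<longleftrightarrow>
     (case D of (c\<^sub>1, c\<^sub>2, c\<^sub>3, c\<^sub>4, c\<^sub>5) \<Rightarrow>
        \<exists>t' t'' u'' u'. conversion F R t c\<^sub>1 t' \<and> opt_forward F R t' c\<^sub>2 t'' \<and>
          conversion F R t'' c\<^sub>3 u'' \<and> opt_backward F R u'' c\<^sub>4 u' \<and> conversion F R u' c\<^sub>5 u)"

definition decreasing_diagram ::
  "(('f, 'v) rule \<Rightarrow> nat) \<Rightarrow> nat \<Rightarrow> nat \<Rightarrow> ('f, 'v) diagram \<Rightarrow> bool" where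
  "decreasing_diagram i \<alpha> \<beta> D \<longleftrightarrow>
     (case D of (c\<^sub>1, c\<^sub>2, c\<^sub>3, c\<^sub>4, c\<^sub>5) \<Rightarrow>
        (\<forall>(\<pi>, _) \<in> set c\<^sub>1. rule_label i \<pi> < \<alpha>) \<and>
        (\<forall>(\<pi>, _) \<in> set c\<^sub>2. rule_label i \<pi> \<le> \<beta>) \<and>
        (\<forall>(\<pi>, _) \<in> set c\<^sub>3. rule_label i \<pi> < \<alpha> \<or> rule_label i \<pi> < \<beta>) \<and>
        (\<forall>(\<pi>, _) \<in> set c\<^sub>4. rule_label i \<pi> \<le> \<alpha>) \<and>
        (\<forall>(\<pi>, _) \<in> set c\<^sub>5. rule_label i \<pi> < \<beta>))"

definition fan_property ::
  "('f \<times> nat) set \<Rightarrow> ('f, 'v) trs \<Rightarrow> ('f, 'v) fterm \<Rightarrow> ('f, 'v) fterm \<Rightarrow> ('f, 'v) diagram \<Rightarrow> bool"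
where
  "fan_property F R s t D \<longleftrightarrow>
     (case D of (c\<^sub>1, c\<^sub>2, c\<^sub>3, c\<^sub>4, c\<^sub>5) \<Rightarrow>
        \<forall>v \<in> set (t # map snd (c\<^sub>1 @ c\<^sub>2 @ c\<^sub>3 @ c\<^sub>4 @ c\<^sub>5)). (rstep F R)\<^sup>*\<^sup>* s v)"

end

theory Submission
  imports Defs "HOL-Library.Multiset"
begin

text \<open>
  Label a rewrite step by its source and the index of its rule. Labels are compared
  lexicographically: sources decrease weakly along all steps and strictly as soon as a duplicating
  step occurs, which is well-founded by relative termination. By the fan property the diagrams of
  the critical peaks remain decreasing. A variable overlap with a non-duplicating rule is closed
  by at most one step on each side; if the rule is duplicating, then all the copied steps start
  strictly below the source of the peak. So every local peak is decreasing, and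
  confluence follows by the conversion version of decreasing diagrams.
\<close>

text \<open>With the index as only label, a variable overlap below a duplicating rule cannot be
  closed in general: the inner step is copied several times with its index unchanged, and a diagram
  leaves room for a single step of that index unless it is smaller than the outer one. The source
  component repairs this, but it has a price at critical peaks: a conversion may climb to terms
  unrelated to the peak, and labels with such sources would be incomparable. Since the source of
  every step is a term of the conversion, whether the step is read forward or backward, the fan
  property keeps all these sources reachable from the source of the peak. What decreases instead is
  the word of labels of an entire conversion, each time one of its peaks is replaced by its
  diagram.\<close>

section \<open>Decreasing diagrams for conversions\<close>

text \<open>
  A conversion is abstracted to the word of its labels, each with a flag telling whether the step
  is forward. A forward step is paired with the part of the word to its left, a backward step with
  the part to its right; words are compared by the multiset extension of the lexicographic order on
  these pairs, where words in the second components are compared recursively.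
\<close>

type_synonym 'l letter = "bool \<times> 'l"

fun letter_contexts :: "'l letter list \<Rightarrow> ('l letter \<times> 'l letter list) multiset" where
  "letter_contexts [] = {#}"
| "letter_contexts (a # w) = add_mset (a, if fst a then [] else w)
     (image_mset (\<lambda>(b, v). (b, if fst b then a # v else v)) (letter_contexts w))"

lemma letter_contexts_snoc:
  "letter_contexts (w @ [a]) = add_mset (a, if \<not> fst a then [] else w)
     (image_mset (\<lambda>(b, v). (b, if \<not> fst b then v @ [a] else v)) (letter_contexts w))"
  by (induction w) (auto simp: multiset.map_comp o_def case_prod_beta intro!: image_mset_cong)

lemma fst_letter_contexts: "(b, v) \<in># letter_contexts w \<Longrightarrow> b \<in> set w"
  by (induction w arbitrary: v) auto

lemma length_letter_contexts: "(b, v) \<in># letter_contexts w \<Longrightarrow> length v < length w"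
  by (induction w arbitrary: v) (auto split: if_splits, fastforce+)

lemma letter_contexts_split:
  "(b, v) \<in># letter_contexts w \<Longrightarrow>
     \<exists>w\<^sub>1 w\<^sub>2. w = w\<^sub>1 @ b # w\<^sub>2 \<and> v = (if fst b then w\<^sub>1 else w\<^sub>2)"
proof (induction w arbitrary: v)
  case (Cons a w)
  from Cons.prems consider "b = a" "v = (if fst a then [] else w)"
    | v' where "(b, v') \<in># letter_contexts w" "v = (if fst b then a # v' else v')"
    by auto
  then show ?case
  proof cases
    case 1
    then show ?thesis by (intro exI[of _ "[]"] exI[of _ w]) auto
  next
    case 2
    from Cons.IH[OF 2(1)] obtain w\<^sub>1 w\<^sub>2
      where "w = w\<^sub>1 @ b # w\<^sub>2" "v' = (if fst b then w\<^sub>1 else w\<^sub>2)" by blast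
    with 2(2) show ?thesis by (intro exI[of _ "a # w\<^sub>1"] exI[of _ w\<^sub>2]) auto
  qed
qed simp

text \<open>The order occurs below \<open>multp\<close> in its own rule, and \<open>multp\<close> is
  monotone, so a least fixed point suffices. The induction rule supplies each recursive comparison
  together with the induction claim; the hypothesis \<open>rec\<close> of
  \<open>word_less_map\<close> has this form.\<close>

inductive word_less :: "('l \<Rightarrow> 'l \<Rightarrow> bool) \<Rightarrow> 'l letter list \<Rightarrow> 'l letter list \<Rightarrow> bool" for L where
  word_lessI: "multp (\<lambda>x y. L (snd (fst x)) (snd (fst y)) \<or>
       fst x = fst y \<and> word_less L (snd x) (snd y)) (letter_contexts v) (letter_contexts w) \<Longrightarrow>
     word_less L v w"

definition context_less ::
  "('l \<Rightarrow> 'l \<Rightarrow> bool) \<Rightarrow> 'l letter \<times> 'l letter list \<Rightarrow> 'l letter \<times> 'l letter list \<Rightarrow> bool"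
where
  "context_less L x y \<longleftrightarrow>
     L (snd (fst x)) (snd (fst y)) \<or> fst x = fst y \<and> word_less L (snd x) (snd y)"

lemma word_less_iff: "word_less L v w \<longleftrightarrow> multp (context_less L) (letter_contexts v) (letter_contexts w)"
  by (subst word_less.simps) (simp add: context_less_def[abs_def])

text \<open>Transitivity comes for free, as \<open>multp\<close> is defined as a transitive
  closure.\<close>

lemma word_less_trans: "word_less L u v \<Longrightarrow> word_less L v w \<Longrightarrow> word_less L u w"
  unfolding word_less_iff multp_def mult_def by (rule trancl_trans)

lemma word_lessI_all:
  assumes "letter_contexts w \<noteq> {#}"
    and "\<And>k. k \<in># letter_contexts v \<Longrightarrow> \<exists>j \<in># letter_contexts w. context_less L k j"
  shows "word_less L v w"
  unfolding word_less_iff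
  using one_step_implies_multp[of "letter_contexts w" "letter_contexts v" "context_less L" "{#}"] assms
  by simp

context
  fixes L :: "'l \<Rightarrow> 'l \<Rightarrow> bool"
  assumes trans_L: "transp L"
begin

lemma context_less_trans: "transp (context_less L)"
  unfolding context_less_def
  by (intro transpI) (auto intro: word_less_trans transpD[OF trans_L])

text \<open>Common core of monotonicity under adding a letter \<open>a\<close> on the left and on
  the right. Contexts on the affected side grow by \<open>g\<close>; equal letters have equal flags,
  so both members of a comparison grow or neither does, and \<open>rec\<close> covers both
  possibilities. The new letter has either the fixed context \<open>u\<close>, and then joins the
  common part of the multisets, or the whole word, and then its pair decreases because
  \<open>v\<close> lies below \<open>w\<close>.\<close>

lemma word_less_map:
  assumes less: "word_less L v w"
    and rec: "multp (\<lambda>x y. L (snd (fst x)) (snd (fst y)) \<or>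
        fst x = fst y \<and> word_less L (snd x) (snd y) \<and> word_less L (g (snd x)) (g (snd y)))
        (letter_contexts v) (letter_contexts w)"
    and v': "letter_contexts v' = add_mset (a, if c then u else v)
        (image_mset (\<lambda>(b, v). (b, if fst b = d then g v else v)) (letter_contexts v))"
    and w': "letter_contexts w' = add_mset (a, if c then u else w)
        (image_mset (\<lambda>(b, v). (b, if fst b = d then g v else v)) (letter_contexts w))"
  shows "word_less L v' w'"
proof -
  let ?r = "\<lambda>x y. L (snd (fst x)) (snd (fst y)) \<or>
        fst x = fst y \<and> word_less L (snd x) (snd y) \<and> word_less L (g (snd x)) (g (snd y))"
  let ?f = "\<lambda>(b, v). (b, if fst b = d then g v else v)"
  have "transp ?r"
    by (intro transpI) (auto intro: word_less_trans transpD[OF trans_L])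
  from multp_implies_one_step[OF this rec] obtain I J K
    where w: "letter_contexts w = I + J" and v: "letter_contexts v = I + K" and J: "J \<noteq> {#}"
      and K: "\<forall>k \<in># K. \<exists>j \<in># J. ?r k j" by blast
  have fK: "\<forall>k \<in># image_mset ?f K. \<exists>j \<in># image_mset ?f J. context_less L k j"
  proof
    fix k assume "k \<in># image_mset ?f K"
    then obtain k' where k': "k' \<in># K" "k = ?f k'" by auto
    with K obtain j where "j \<in># J" "?r k' j" by blast
    with k' show "\<exists>j \<in># image_mset ?f J. context_less L k j"
      by (intro bexI[of _ "?f j"]) (auto simp: context_less_def split: prod.splits)
  qed
  show ?thesis
  proof (cases c)
    case True
    then show ?thesis unfolding word_less_iff v' w' v w
      using one_step_implies_multp[OF _ fK, of "add_mset (a, u) (image_mset ?f I)"] J by simp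
  next
    case False
    have "\<forall>k \<in># add_mset (a, v) (image_mset ?f K).
        \<exists>j \<in># add_mset (a, w) (image_mset ?f J). context_less L k j"
      using fK less by (auto simp: context_less_def)
    from one_step_implies_multp[OF _ this, of "image_mset ?f I"]
    show ?thesis unfolding word_less_iff v' w' v w using J False by simp
  qed
qed

lemma word_less_Cons: "word_less L v w \<Longrightarrow> word_less L (a # v) (a # w)"
proof (induction rule: word_less.induct)
  case (word_lessI v w)
  have "word_less L v w"
    unfolding word_less_iff using word_lessI.IH
    by (rule mono_multp[THEN predicate2D, rotated]) (auto simp: context_less_def)
  show ?case
    by (rule word_less_map[OF \<open>word_less L v w\<close>, where a = a and c = "fst a" and d = True and u = "[]" and g = "(#) a"])
      (use word_lessI in simp_all)
qed

lemma word_less_snoc: "word_less L v w \<Longrightarrow> word_less L (v @ [a]) (w @ [a])"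
proof (induction rule: word_less.induct)
  case (word_lessI v w)
  have "word_less L v w"
    unfolding word_less_iff using word_lessI.IH
    by (rule mono_multp[THEN predicate2D, rotated]) (auto simp: context_less_def)
  show ?case
    by (rule word_less_map[OF \<open>word_less L v w\<close>, where a = a and c = "\<not> fst a" and d = False and u = "[]"
          and g = "\<lambda>v. v @ [a]"])
      (use word_lessI letter_contexts_snoc[of _ a] in simp_all)
qed

lemma word_less_append: "word_less L v w \<Longrightarrow> word_less L (p @ v @ q) (p @ w @ q)"
proof -
  assume "word_less L v w"
  then have "word_less L (v @ q) (w @ q)"
    by (induction q rule: rev_induct) (use word_less_snoc in force)+
  then show ?thesis by (induction p) (use word_less_Cons in simp_all)
qed

lemma word_less_subword: "p \<noteq> [] \<or> q \<noteq> [] \<Longrightarrow> word_less L v (p @ v @ q)"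
proof -
  have single: "word_less L [] [a]" for a by (rule word_lessI_all) auto
  have nonempty: "word_less L [] w" if "w \<noteq> []" for w
    using that
  proof (induction w)
    case (Cons a w)
    show ?case
    proof (cases "w = []")
      case False
      with Cons.IH word_less_append[OF single[of a], of "[]" w] show ?thesis
        using word_less_trans by fastforce
    qed (use single in simp)
  qed simp
  assume "p \<noteq> [] \<or> q \<noteq> []"
  show ?thesis
  proof (cases "q = []")
    case True
    with \<open>p \<noteq> [] \<or> q \<noteq> []\<close> word_less_append[OF nonempty[of p], of "[]" v] show ?thesis by simp
  next
    case False
    have q: "word_less L v (v @ q)" using word_less_append[OF nonempty[OF False], of v "[]"] by simp
    show ?thesis
    proof (cases "p = []")
      case False
      with word_less_append[OF nonempty[of p], of "[]" "v @ q"] q show ?thesis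
        using word_less_trans by fastforce
    qed (use q in simp)
  qed
qed

text \<open>A context omits its own letter, so it is a proper prefix or suffix of the word.\<close>

lemma letter_contexts_word_less: "(b, v) \<in># letter_contexts w \<Longrightarrow> word_less L v w"
proof -
  assume "(b, v) \<in># letter_contexts w"
  then obtain w\<^sub>1 w\<^sub>2 where "w = w\<^sub>1 @ b # w\<^sub>2" "v = (if fst b then w\<^sub>1 else w\<^sub>2)"
    using letter_contexts_split by blast
  then show ?thesis
    using word_less_subword[of "[]" "b # w\<^sub>2" w\<^sub>1] word_less_subword[of "w\<^sub>1 @ [b]" "[]" w\<^sub>2]
    by (cases "fst b") simp_all
qed

text \<open>
  As for recursive path orders, a word is accessible as soon as its contexts are: each smaller word
  has smaller accessible contexts, by transitivity and induction on its length.
\<close>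

lemma wfp_word_less:
  assumes "wfp L"
  shows "wfp (word_less L)"
proof -
  define A where "A = {w. Wellfounded.accp (word_less L) w}"
  \<comment> \<open>Only accessible words may serve as upper bounds in the second component, so
    \<open>r\<close> is well-founded before anything is known about \<open>word_less\<close> as a
    whole.\<close>
  define r where "r = (\<lambda>(x :: 'l letter \<times> 'l letter list) y. L (snd (fst x)) (snd (fst y)) \<or>
      fst x = fst y \<and> word_less L (snd x) (snd y) \<and> snd y \<in> A)"
  have "wf {(x, y). word_less L x y \<and> y \<in> A}"
    unfolding wf_def
  proof (intro allI impI)
    fix P x
    assume *: "\<forall>x. (\<forall>y. (y, x) \<in> {(x, y). word_less L x y \<and> y \<in> A} \<longrightarrow> P y) \<longrightarrow> P x"
    show "P x"
    proof (cases "x \<in> A")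
      case True
      then have "Wellfounded.accp (word_less L) x" by (simp add: A_def)
      then show ?thesis by (induction rule: accp.induct) (use * in blast)
    qed (use * in blast)
  qed
  moreover have "wf {(x :: 'l letter, y). L (snd x) (snd y)}"
    using wf_inv_image[of "{(x, y). L x y}" snd] assms
    by (simp add: inv_image_def wfp_def)
  ultimately have "wf ({(x :: 'l letter, y). L (snd x) (snd y)} <*lex*> {(x, y). word_less L x y \<and> y \<in> A})"
    by blast
  moreover have "{(x, y). r x y} = {(x, y). L (snd x) (snd y)} <*lex*> {(x, y). word_less L x y \<and> y \<in> A}"
    by (auto simp: r_def)
  ultimately have "wf (mult {(x, y). r x y})" by (simp add: wf_mult)
  then have acc: "(\<forall>(b, v) \<in># letter_contexts w. v \<in> A) \<longrightarrow> w \<in> A" for w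
  proof (induction "letter_contexts w" arbitrary: w rule: wf_induct_rule)
    case less
    note IH = less
    show ?case
    proof
      assume w: "\<forall>(b, v) \<in># letter_contexts w. v \<in> A"
      have "u \<in> A" if "word_less L u w" for u
        using that
      proof (induction "length u" arbitrary: u rule: less_induct)
        case (less u)
        have u: "\<forall>(b, v) \<in># letter_contexts u. v \<in> A"
          using less letter_contexts_word_less length_letter_contexts word_less_trans by fast
        from less.prems multp_implies_one_step[OF context_less_trans] obtain I J K
          where IJK: "letter_contexts w = I + J" "letter_contexts u = I + K" "J \<noteq> {#}"
            "\<forall>k \<in># K. \<exists>j \<in># J. context_less L k j"
          unfolding word_less_iff by blast
        \<comment> \<open>Since the contexts of \<open>w\<close> are accessible, a comparison by
          \<open>context_less\<close> with one of its pairs is a comparison by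
          \<open>r\<close>.\<close>
        have "\<forall>k \<in># K. \<exists>j \<in># J. (k, j) \<in> {(x, y). r x y}"
        proof
          fix k assume "k \<in># K"
          with IJK obtain j where j: "j \<in># J" "context_less L k j" by blast
          with w IJK(1) have "snd j \<in> A" by (cases j) auto
          with j show "\<exists>j \<in># J. (k, j) \<in> {(x, y). r x y}" by (auto simp: r_def context_less_def)
        qed
        from one_step_implies_mult[OF IJK(3) this, of I]
        show ?case using IH[of u] IJK u by simp
      qed
      then show "w \<in> A" unfolding A_def by (auto intro: accp.accI)
    qed
  qed
  have "w \<in> A" for w
    by (induction "length w" arbitrary: w rule: less_induct)
      (use acc length_letter_contexts in fast)
  then show ?thesis by (simp add: A_def wfp_iff_accp accp_wfpI)
qed

text \<open>Each pair of the diagram lies below one of the two pairs of the peak. Letters with a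
  smaller label are settled by the label alone. The optional forward step repeats the letter with
  label \<beta>, whose context in the peak is the step labelled \<alpha>; its new context is
  \<open>c\<^sub>1\<close>, where all labels are below \<alpha>. The optional backward step is
  symmetric, with \<open>c\<^sub>5\<close> and \<beta>. This is why forward letters look left and
  backward letters look right.\<close>

lemma decreasing_word_less:
  assumes "\<forall>a \<in> set c\<^sub>1. L (snd a) \<alpha>" "c\<^sub>2 = [] \<or> c\<^sub>2 = [(True, \<beta>)]"
    "\<forall>a \<in> set c\<^sub>3. L (snd a) \<alpha> \<or> L (snd a) \<beta>" "c\<^sub>4 = [] \<or> c\<^sub>4 = [(False, \<alpha>)]"
    "\<forall>a \<in> set c\<^sub>5. L (snd a) \<beta>"
  shows "word_less L (c\<^sub>1 @ c\<^sub>2 @ c\<^sub>3 @ c\<^sub>4 @ c\<^sub>5) [(False, \<alpha>), (True, \<beta>)]"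
proof (rule word_lessI_all)
  have small: "word_less L c [(d, \<gamma>)]" if "\<forall>a \<in> set c. L (snd a) \<gamma>" for c d \<gamma>
    by (rule word_lessI_all) (use that fst_letter_contexts in \<open>fastforce simp: context_less_def\<close>)+
  fix k assume k: "k \<in># letter_contexts (c\<^sub>1 @ c\<^sub>2 @ c\<^sub>3 @ c\<^sub>4 @ c\<^sub>5)"
  have ms: "letter_contexts [(False, \<alpha>), (True, \<beta>)] =
      {#((False, \<alpha>), [(True, \<beta>)]), ((True, \<beta>), [(False, \<alpha>)])#}" by simp
  show "\<exists>j \<in># letter_contexts [(False, \<alpha>), (True, \<beta>)]. context_less L k j"
  proof (cases "L (snd (fst k)) \<alpha> \<or> L (snd (fst k)) \<beta>")
    case True
    then show ?thesis unfolding ms by (auto simp: context_less_def)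
  next
    case False
    obtain b v where kb: "k = (b, v)" by (cases k)
    from letter_contexts_split[OF k[unfolded kb]] obtain w\<^sub>1 w\<^sub>2
      where w: "c\<^sub>1 @ c\<^sub>2 @ c\<^sub>3 @ c\<^sub>4 @ c\<^sub>5 = w\<^sub>1 @ b # w\<^sub>2" and v: "v = (if fst b then w\<^sub>1 else w\<^sub>2)"
      by blast
    have notin: "b \<notin> set c\<^sub>1" "b \<notin> set c\<^sub>3" "b \<notin> set c\<^sub>5" using False assms kb by auto
    have "b \<in> set (c\<^sub>1 @ c\<^sub>2 @ c\<^sub>3 @ c\<^sub>4 @ c\<^sub>5)" unfolding w by simp
    with notin assms(2,4) consider "c\<^sub>2 = [b]" "b = (True, \<beta>)" | "c\<^sub>4 = [b]" "b = (False, \<alpha>)"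
      by fastforce
    then show ?thesis
    proof cases
      case 1
      \<comment> \<open>The flag tells \<open>b\<close> from the letter of \<open>c\<^sub>4\<close>
        even if the labels coincide, so \<open>b\<close> occurs only once and its left context must
        be \<open>c\<^sub>1\<close>.\<close>
      with w notin assms(4) have "w\<^sub>1 = c\<^sub>1"
        using append_Cons_eq_iff[of b c\<^sub>1 "c\<^sub>3 @ c\<^sub>4 @ c\<^sub>5" w\<^sub>1 w\<^sub>2] by auto
      with 1 v kb small[OF assms(1)] show ?thesis unfolding ms by (simp add: context_less_def)
    next
      case 2
      with w notin assms(2) have "w\<^sub>2 = c\<^sub>5"
        using append_Cons_eq_iff[of b "c\<^sub>1 @ c\<^sub>2 @ c\<^sub>3" c\<^sub>5 w\<^sub>1 w\<^sub>2] by auto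
      with 2 v kb small[OF assms(5)] show ?thesis unfolding ms by (simp add: context_less_def)
    qed
  qed
qed simp

end

section \<open>Labelled conversions and confluence of abstract systems\<close>

inductive labeled_conv :: "('l \<Rightarrow> 'a \<Rightarrow> 'a \<Rightarrow> bool) \<Rightarrow> 'a \<Rightarrow> 'l letter list \<Rightarrow> 'a \<Rightarrow> bool"
  for st where
  labeled_conv_Nil: "labeled_conv st x [] x"
| labeled_conv_forward: "st l x z \<Longrightarrow> labeled_conv st z w y \<Longrightarrow> labeled_conv st x ((True, l) # w) y"
| labeled_conv_backward: "st l z x \<Longrightarrow> labeled_conv st z w y \<Longrightarrow> labeled_conv st x ((False, l) # w) y"

inductive_cases labeled_conv_NilE [elim!]: "labeled_conv st x [] y"
inductive_cases labeled_conv_forwardE [elim!]: "labeled_conv st x ((True, l) # w) y"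
inductive_cases labeled_conv_backwardE [elim!]: "labeled_conv st x ((False, l) # w) y"

lemma labeled_conv_append:
  "labeled_conv st x (v @ w) y \<longleftrightarrow> (\<exists>z. labeled_conv st x v z \<and> labeled_conv st z w y)"
proof
  show "labeled_conv st x (v @ w) y \<Longrightarrow> \<exists>z. labeled_conv st x v z \<and> labeled_conv st z w y"
  proof (induction v arbitrary: x)
    case (Cons a v)
    obtain d l where "a = (d, l)" by (cases a)
    with Cons show ?case by (cases d) (auto, (blast intro: labeled_conv.intros)+)
  qed (auto intro: labeled_conv.intros)
next
  assume "\<exists>z. labeled_conv st x v z \<and> labeled_conv st z w y"
  then obtain z where "labeled_conv st x v z" "labeled_conv st z w y" by blast
  then show "labeled_conv st x (v @ w) y"
    by (induction rule: labeled_conv.induct) (auto intro: labeled_conv.intros)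
qed

lemma labeled_conv_rtranclp:
  assumes "(\<lambda>x y. \<exists>\<gamma>. P \<gamma> \<and> (st \<gamma> x y \<or> st \<gamma> y x))\<^sup>*\<^sup>* x y"
  shows "\<exists>w. labeled_conv st x w y \<and> (\<forall>a \<in> set w. P (snd a))"
  using assms
proof (induction rule: converse_rtranclp_induct)
  case base
  show ?case by (intro exI[of _ "[]"]) (auto intro: labeled_conv.intros)
next
  case (step x z)
  then obtain w \<gamma> where w: "labeled_conv st z w y" "\<forall>a \<in> set w. P (snd a)"
    and "P \<gamma>" "st \<gamma> x z \<or> st \<gamma> z x" by blast
  from this(4) show ?case
  proof
    assume "st \<gamma> x z"
    with w \<open>P \<gamma>\<close> show ?thesis
      by (intro exI[of _ "(True, \<gamma>) # w"]) (auto intro: labeled_conv.intros)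
  next
    assume "st \<gamma> z x"
    with w \<open>P \<gamma>\<close> show ?thesis
      by (intro exI[of _ "(False, \<gamma>) # w"]) (auto intro: labeled_conv.intros)
  qed
qed

lemma word_peak_or_valley:
  "(\<exists>p q \<alpha> \<beta>. w = p @ [(False, \<alpha>), (True, \<beta>)] @ q) \<or>
   (\<exists>u v. w = u @ v \<and> (\<forall>a \<in> set u. fst a) \<and> (\<forall>a \<in> set v. \<not> fst a))"
proof (induction w)
  case (Cons a w)
  from Cons.IH show ?case
  proof
    assume "\<exists>p q \<alpha> \<beta>. w = p @ [(False, \<alpha>), (True, \<beta>)] @ q"
    then show ?thesis by (metis append_Cons)
  next
    assume "\<exists>u v. w = u @ v \<and> (\<forall>a \<in> set u. fst a) \<and> (\<forall>a \<in> set v. \<not> fst a)"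
    then obtain u v where uv: "w = u @ v" "\<forall>a \<in> set u. fst a" "\<forall>a \<in> set v. \<not> fst a" by blast
    show ?thesis
    proof (cases "fst a")
      case True
      with uv show ?thesis by (intro disjI2 exI[of _ "a # u"] exI[of _ v]) auto
    next
      case False
      obtain \<alpha> where a: "a = (False, \<alpha>)" using False by (cases a) auto
      show ?thesis
      proof (cases u)
        case Nil
        with uv a show ?thesis by (intro disjI2 exI[of _ "[]"] exI[of _ "a # v"]) auto
      next
        case (Cons b u')
        with uv obtain \<beta> where "b = (True, \<beta>)" by (cases b) auto
        with Cons uv a have "a # w = [] @ [(False, \<alpha>), (True, \<beta>)] @ u' @ v" by simp
        then show ?thesis by blast
      qed
    qed
  qed
qed auto

text \<open>Replacing a peak inside a conversion by its diagram lowers the word of labels, and a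
  word without peaks spells a valley. So well-founded induction on words joins the ends of every
  conversion. One step may carry many labels, which the application to rewriting exploits.\<close>

theorem decreasing_diagrams:
  fixes st :: "'l \<Rightarrow> 'a \<Rightarrow> 'a \<Rightarrow> bool" and L :: "'l \<Rightarrow> 'l \<Rightarrow> bool"
  defines "below P \<equiv> \<lambda>x y. \<exists>\<gamma>. P \<gamma> \<and> (st \<gamma> x y \<or> st \<gamma> y x)"
  assumes "wfp L" "transp L"
    and peak: "\<And>\<alpha> \<beta> x y z. st \<alpha> x y \<Longrightarrow> st \<beta> x z \<Longrightarrow> \<exists>y' y'' z'' z'.
       (below (\<lambda>\<gamma>. L \<gamma> \<alpha>))\<^sup>*\<^sup>* y y' \<and> (st \<beta>)\<^sup>=\<^sup>= y' y'' \<and>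
       (below (\<lambda>\<gamma>. L \<gamma> \<alpha> \<or> L \<gamma> \<beta>))\<^sup>*\<^sup>* y'' z'' \<and>
       (st \<alpha>)\<^sup>=\<^sup>= z' z'' \<and> (below (\<lambda>\<gamma>. L \<gamma> \<beta>))\<^sup>*\<^sup>* z' z"
  shows "confluentp (\<lambda>x y. \<exists>\<alpha>. st \<alpha> x y)"
proof (rule confluentpI)
  let ?S = "\<lambda>x y. \<exists>\<alpha>. st \<alpha> x y"
  have join: "labeled_conv st x w y \<Longrightarrow> \<exists>u. ?S\<^sup>*\<^sup>* x u \<and> ?S\<^sup>*\<^sup>* y u" for x w y
    using wfp_word_less[OF \<open>transp L\<close> \<open>wfp L\<close>]
  proof (induction w arbitrary: x y rule: wfp_induct_rule)
    case (less w)
    from word_peak_or_valley[of w] show ?case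
    proof (elim disjE exE conjE)
      fix p q \<alpha> \<beta> assume w: "w = p @ [(False, \<alpha>), (True, \<beta>)] @ q"
      with less.prems obtain a b s where ab: "labeled_conv st x p a" "st \<alpha> s a" "st \<beta> s b"
        "labeled_conv st b q y"
        by (auto simp: labeled_conv_append)
      from peak[OF ab(2,3), unfolded below_def] obtain a' a'' b'' b'
        where d: "(\<lambda>x y. \<exists>\<gamma>. L \<gamma> \<alpha> \<and> (st \<gamma> x y \<or> st \<gamma> y x))\<^sup>*\<^sup>* a a'" "(st \<beta>)\<^sup>=\<^sup>= a' a''"
          "(\<lambda>x y. \<exists>\<gamma>. (L \<gamma> \<alpha> \<or> L \<gamma> \<beta>) \<and> (st \<gamma> x y \<or> st \<gamma> y x))\<^sup>*\<^sup>* a'' b''" "(st \<alpha>)\<^sup>=\<^sup>= b' b''"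
          "(\<lambda>x y. \<exists>\<gamma>. L \<gamma> \<beta> \<and> (st \<gamma> x y \<or> st \<gamma> y x))\<^sup>*\<^sup>* b' b" by blast
      obtain c\<^sub>1 where c1: "labeled_conv st a c\<^sub>1 a'" "\<forall>a \<in> set c\<^sub>1. L (snd a) \<alpha>"
        using labeled_conv_rtranclp[OF d(1)] by blast
      obtain c\<^sub>3 where c3: "labeled_conv st a'' c\<^sub>3 b''" "\<forall>a \<in> set c\<^sub>3. L (snd a) \<alpha> \<or> L (snd a) \<beta>"
        using labeled_conv_rtranclp[OF d(3)] by blast
      obtain c\<^sub>5 where c5: "labeled_conv st b' c\<^sub>5 b" "\<forall>a \<in> set c\<^sub>5. L (snd a) \<beta>"
        using labeled_conv_rtranclp[OF d(5)] by blast
      obtain c\<^sub>2 where c2: "labeled_conv st a' c\<^sub>2 a''" "c\<^sub>2 = [] \<or> c\<^sub>2 = [(True, \<beta>)]"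
        using d(2) by (auto intro: labeled_conv_Nil labeled_conv_forward[OF _ labeled_conv_Nil])
      obtain c\<^sub>4 where c4: "labeled_conv st b'' c\<^sub>4 b'" "c\<^sub>4 = [] \<or> c\<^sub>4 = [(False, \<alpha>)]"
        using d(4) by (auto intro: labeled_conv_Nil labeled_conv_backward[OF _ labeled_conv_Nil])
      let ?w = "p @ (c\<^sub>1 @ c\<^sub>2 @ c\<^sub>3 @ c\<^sub>4 @ c\<^sub>5) @ q"
      have "word_less L ?w w"
        unfolding w
        by (intro word_less_append decreasing_word_less \<open>transp L\<close> c1 c2 c3 c4 c5)
      moreover have "labeled_conv st x ?w y"
        unfolding labeled_conv_append using ab(1,4) c1(1) c2(1) c3(1) c4(1) c5(1) by blast
      ultimately show ?thesis using less.IH by blast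
    next
      fix u v assume uv: "w = u @ v" "\<forall>a \<in> set u. fst a" "\<forall>a \<in> set v. \<not> fst a"
      with less.prems obtain z where "labeled_conv st x u z" "labeled_conv st z v y"
        by (auto simp: labeled_conv_append)
      moreover have "labeled_conv st x u z \<Longrightarrow> \<forall>a \<in> set u. fst a \<Longrightarrow> ?S\<^sup>*\<^sup>* x z" for x u z
        by (induction rule: labeled_conv.induct) (auto intro: converse_rtranclp_into_rtranclp)
      moreover have "labeled_conv st z v y \<Longrightarrow> \<forall>a \<in> set v. \<not> fst a \<Longrightarrow> ?S\<^sup>*\<^sup>* y z" for z v y
        by (induction rule: labeled_conv.induct) (auto intro: rtranclp.rtrancl_into_rtrancl)
      ultimately show ?thesis using uv by blast
    qed
  qed
  have fwd: "?S\<^sup>*\<^sup>* x y \<Longrightarrow> \<exists>w. labeled_conv st x w y" for x y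
    by (induction rule: converse_rtranclp_induct) (blast intro: labeled_conv.intros)+
  have bwd: "?S\<^sup>*\<^sup>* x y \<Longrightarrow> labeled_conv st x v z \<Longrightarrow> \<exists>w. labeled_conv st y w z" for x y v z
    by (induction arbitrary: v rule: rtranclp_induct) (blast intro: labeled_conv.intros)+
  fix x y z assume "?S\<^sup>*\<^sup>* x y" "?S\<^sup>*\<^sup>* x z"
  with fwd bwd obtain w where "labeled_conv st y w z" by blast
  then show "\<exists>u. ?S\<^sup>*\<^sup>* y u \<and> ?S\<^sup>*\<^sup>* z u" by (rule join)
qed

section \<open>Unification and renaming\<close>

lemma subst_subst: "t \<cdot> \<sigma> \<cdot> \<tau> = t \<cdot> (\<lambda>x. \<sigma> x \<cdot> \<tau>)"
  by (induction t) auto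

lemma subst_cong: "(\<And>x. x \<in> vars t \<Longrightarrow> \<sigma> x = \<tau> x) \<Longrightarrow> t \<cdot> \<sigma> = t \<cdot> \<tau>"
  by (induction t) auto

lemma subst_Var [simp]: "t \<cdot> Var = t"
  by (induction t) (auto simp: map_idI)

lemma finite_vars [simp]: "finite (vars t)"
  by (induction t) auto

lemma vars_subst: "vars (t \<cdot> \<sigma>) = (\<Union>x \<in> vars t. vars (\<sigma> x))"
  by (induction t) auto

lemma size_subst_less:
  assumes "x \<in> vars t" "t \<noteq> Var x"
  shows "size (\<sigma> x) < size (t \<cdot> \<sigma>)"
  using assms
proof (induction t)
  case (Fun f ts)
  then obtain t where t: "t \<in> set ts" "x \<in> vars t" by auto
  have "size (\<sigma> x) \<le> size (t \<cdot> \<sigma>)" using Fun.IH[OF t(1)] t(2) by (cases "t = Var x") auto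
  also have "\<dots> \<le> size_list size (map (\<lambda>t. t \<cdot> \<sigma>) ts)"
    using t(1) by (intro size_list_estimation'[of "t \<cdot> \<sigma>"]) auto
  finally show ?case by simp
qed simp

section \<open>First-order unification\<close>

definition unifies :: "('f, 'v) subst \<Rightarrow> (('f, 'v) fterm \<times> ('f, 'v) fterm) list \<Rightarrow> bool" where
  "unifies \<tau> E \<longleftrightarrow> (\<forall>(s, t) \<in> set E. s \<cdot> \<tau> = t \<cdot> \<tau>)"

lemma unifies_simps [simp]:
  "unifies \<tau> []"
  "unifies \<tau> ((s, t) # E) \<longleftrightarrow> s \<cdot> \<tau> = t \<cdot> \<tau> \<and> unifies \<tau> E"
  "unifies \<tau> (E @ E') \<longleftrightarrow> unifies \<tau> E \<and> unifies \<tau> E'"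
  by (auto simp: unifies_def)

text \<open>Idempotent form of a most general unifier: every unifier \<tau> factors as \<mu>
  followed by \<tau> itself. With the second factor fixed in this way, variable elimination composes
  without any choice of instantiating substitutions.\<close>

definition idem_mgu :: "('f, 'v) subst \<Rightarrow> (('f, 'v) fterm \<times> ('f, 'v) fterm) list \<Rightarrow> bool" where
  "idem_mgu \<mu> E \<longleftrightarrow> unifies \<mu> E \<and> (\<forall>\<tau>. unifies \<tau> E \<longrightarrow> (\<forall>x. \<tau> x = \<mu> x \<cdot> \<tau>))"

definition vars_eqs :: "(('f, 'v) fterm \<times> ('f, 'v) fterm) list \<Rightarrow> 'v set" where
  "vars_eqs E = (\<Union>(s, t) \<in> set E. vars s \<union> vars t)"

lemma finite_vars_eqs: "finite (vars_eqs E)"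
  by (auto simp: vars_eqs_def)

lemma vars_eqs_simps [simp]:
  "vars_eqs ((s, t) # E) = vars s \<union> vars t \<union> vars_eqs E"
  "vars_eqs (E @ E') = vars_eqs E \<union> vars_eqs E'"
  by (auto simp: vars_eqs_def)

text \<open>The \<open>Suc\<close> for each equation makes the removal of a trivial equation
  count.\<close>

definition size_eqs :: "(('f, 'v) fterm \<times> ('f, 'v) fterm) list \<Rightarrow> nat" where
  "size_eqs E = sum_list (map (\<lambda>(s, t). Suc (size s + size t)) E)"

lemma size_eqs_zip:
  "length ss = length ts \<Longrightarrow>
     size_eqs (zip ss ts @ E) < size_eqs ((Fun f ss, Fun g ts) # E)"
  by (induction ss ts rule: list_induct2) (auto simp: size_eqs_def)

lemma vars_eqs_zip:
  "length ss = length ts \<Longrightarrow> vars_eqs (zip ss ts) = (\<Union>s \<in> set ss \<union> set ts. vars s)"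
  by (induction ss ts rule: list_induct2) (auto simp: vars_eqs_def)

lemma unifies_zip:
  "length ss = length ts \<Longrightarrow>
     unifies \<tau> (zip ss ts) \<longleftrightarrow> map (\<lambda>t. t \<cdot> \<tau>) ss = map (\<lambda>t. t \<cdot> \<tau>) ts"
  by (induction ss ts rule: list_induct2) auto

text \<open>A unifier of \<open>x\<close> and \<open>t\<close> does not change when the binding of
  \<open>x\<close> to \<open>t\<close> is applied before it. Hence it also unifies the remaining
  equations after this substitution. There \<open>x\<close> no longer occurs, so the number of
  variables falls, and the binding followed by the unifier obtained for them solves the given
  problem.\<close>

lemma idem_mgu_eliminate:
  fixes t :: "('f, 'v) fterm"
  assumes "x \<notin> vars t" and \<tau>: "unifies \<tau> ((Var x, t) # E)"
    and IH: "\<And>E' \<tau>. card (vars_eqs E') < card (vars_eqs ((Var x, t) # E)) \<Longrightarrow> unifies \<tau> E' \<Longrightarrow>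
       \<exists>\<mu> :: ('f, 'v) subst. idem_mgu \<mu> E'"
  shows "\<exists>\<mu>. idem_mgu \<mu> ((Var x, t) # E)"
proof -
  let ?\<theta> = "Var(x := t)"
  let ?E = "map (\<lambda>(s, u). (s \<cdot> ?\<theta>, u \<cdot> ?\<theta>)) E"
  have *: "\<And>y. \<tau> y = ?\<theta> y \<cdot> \<tau>" if "unifies \<tau> ((Var x, t) # E)" for \<tau> :: "('f, 'v) subst"
    using that by auto
  have E: "unifies \<tau> ?E \<longleftrightarrow> unifies (\<lambda>y. ?\<theta> y \<cdot> \<tau>) E" for \<tau>
    by (auto simp: unifies_def subst_subst)
  have E': "unifies \<tau> ?E" if "unifies \<tau> ((Var x, t) # E)" for \<tau> :: "('f, 'v) subst"
  proof -
    have "(\<lambda>y. ?\<theta> y \<cdot> \<tau>) = \<tau>" using *[OF that] by (simp add: fun_eq_iff)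
    with E[of \<tau>] that show ?thesis by simp
  qed
  have "vars_eqs ?E \<subseteq> vars_eqs ((Var x, t) # E) - {x}"
    using \<open>x \<notin> vars t\<close> by (fastforce simp: vars_eqs_def vars_subst split: if_splits)
  then have "card (vars_eqs ?E) < card (vars_eqs ((Var x, t) # E))"
    using finite_vars_eqs[of "(Var x, t) # E"]
    by (intro psubset_card_mono) auto
  from IH[OF this E'[OF \<tau>]] obtain \<mu> where \<mu>: "idem_mgu \<mu> ?E" by blast
  have t: "t \<cdot> (\<lambda>y. ?\<theta> y \<cdot> \<mu>) = t \<cdot> \<mu>" by (rule subst_cong) (use \<open>x \<notin> vars t\<close> in auto)
  have "idem_mgu (\<lambda>y. ?\<theta> y \<cdot> \<mu>) ((Var x, t) # E)"
    unfolding idem_mgu_def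
  proof (intro conjI allI impI)
    show "unifies (\<lambda>y. ?\<theta> y \<cdot> \<mu>) ((Var x, t) # E)"
      using \<mu> E[of \<mu>] t by (simp add: idem_mgu_def)
  next
    fix \<tau> y assume \<tau>: "unifies \<tau> ((Var x, t) # E)"
    with E' \<mu> have "\<And>z. \<tau> z = \<mu> z \<cdot> \<tau>" by (auto simp: idem_mgu_def)
    then have "?\<theta> y \<cdot> \<mu> \<cdot> \<tau> = ?\<theta> y \<cdot> \<tau>" unfolding subst_subst by (intro subst_cong) simp
    with *[OF \<tau>, of y] show "\<tau> y = ?\<theta> y \<cdot> \<mu> \<cdot> \<tau>" by simp
  qed
  then show ?thesis by blast
qed

lemma idem_mgu_exists:
  fixes E :: "(('f, 'v) fterm \<times> ('f, 'v) fterm) list"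
  assumes "unifies \<tau> E"
  shows "\<exists>\<mu>. idem_mgu \<mu> E"
  using assms
proof (induction E arbitrary: \<tau> rule: wf_induct_rule[OF wf_measures[of "[card \<circ> vars_eqs, size_eqs]"]])
  case (1 E)
  have IH: "\<exists>\<mu>. idem_mgu \<mu> E'"
    if "card (vars_eqs E') < card (vars_eqs E) \<or>
        card (vars_eqs E') = card (vars_eqs E) \<and> size_eqs E' < size_eqs E" "unifies \<tau> E'"
    for E' :: "(('f, 'v) fterm \<times> ('f, 'v) fterm) list" and \<tau>
    using 1(1)[of E' \<tau>] that by auto
  \<comment> \<open>Occurs check: a proper occurrence of \<open>x\<close> in \<open>t\<close> would
    make the term \<tau> x smaller than itself, so a solvable problem never fails here.\<close>
  have occurs: "x \<notin> vars t" if "\<tau> x = t \<cdot> \<tau>" "t \<noteq> Var x" for x and t :: "('f, 'v) fterm"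
    using size_subst_less[of x t \<tau>] that by auto
  show ?case
  proof (cases E)
    case Nil
    then show ?thesis by (intro exI[of _ Var]) (auto simp: idem_mgu_def)
  next
    case (Cons st E')
    obtain s t where E: "E = (s, t) # E'" using Cons by (cases st) auto
    have unif: "s \<cdot> \<tau> = t \<cdot> \<tau>" "unifies \<tau> E'" using 1(2) E by auto
    consider "s = t" | x where "s = Var x" "s \<noteq> t" | x where "t = Var x" "s \<noteq> t"
      | f ss g ts where "s = Fun f ss" "t = Fun g ts"
      by (cases s; cases t) auto
    then show ?thesis
    proof cases
      case 1
      have "card (vars_eqs E') \<le> card (vars_eqs E)"
        using finite_vars_eqs[of E] unfolding E by (intro card_mono) auto
      moreover have "size_eqs E' < size_eqs E" by (simp add: E size_eqs_def)
      ultimately obtain \<mu> where "idem_mgu \<mu> E'" using IH[OF _ unif(2)] by (auto simp: le_less)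
      with 1 E show ?thesis by (auto simp: idem_mgu_def)
    next
      case (2 x)
      have "x \<notin> vars t" using occurs[of x t] unif 2 by auto
      then show ?thesis
        unfolding E \<open>s = Var x\<close>
        by (rule idem_mgu_eliminate[of _ _ \<tau>])
          (use unif 2 E in simp, use 2 E in \<open>intro IH, simp_all\<close>)
    next
      case (3 x)
      have "x \<notin> vars s" using occurs[of x s] unif 3 by auto
      have "vars_eqs ((Var x, s) # E') = vars_eqs E" using 3 E by auto
      then have "\<exists>\<mu>. idem_mgu \<mu> ((Var x, s) # E')"
        by (intro idem_mgu_eliminate[OF \<open>x \<notin> vars s\<close>, of \<tau>])
          (use unif 3 in simp, intro IH, simp_all)
      then obtain \<mu> where "idem_mgu \<mu> ((Var x, s) # E')" by blast
      then have "idem_mgu \<mu> E" using 3 E by (simp add: idem_mgu_def eq_commute[of "s \<cdot> _"])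
      then show ?thesis by blast
    next
      case (4 f ss g ts)
      with unif(1) have fg: "f = g" and len: "length ss = length ts"
        and args: "map (\<lambda>t. t \<cdot> \<tau>) ss = map (\<lambda>t. t \<cdot> \<tau>) ts"
        by (auto dest: map_eq_imp_length_eq)
      have "vars_eqs (zip ss ts @ E') = vars_eqs E" using 4 E vars_eqs_zip[OF len] by auto
      then obtain \<mu> where "idem_mgu \<mu> (zip ss ts @ E')"
        using IH[of "zip ss ts @ E'" \<tau>] size_eqs_zip[OF len, of E' f g] 4 E unif(2) args
          unifies_zip[OF len] by auto
      then have "idem_mgu \<mu> E" using 4 E fg unifies_zip[OF len] by (simp add: idem_mgu_def)
      then show ?thesis by blast
    qed
  qed
qed

lemma is_mgu_exists: "s \<cdot> \<tau> = t \<cdot> \<tau> \<Longrightarrow> \<exists>\<mu>. is_mgu \<mu> s t"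
  using idem_mgu_exists[of \<tau> "[(s, t)]"] by (fastforce simp: is_mgu_def idem_mgu_def)

text \<open>\<open>variant_of\<close> asks for a bijection on all variables. Exchanging
  \<open>V\<close> with a set \<open>U\<close> of the same size, disjoint from both \<open>V\<close>
  and \<open>W\<close>, and fixing everything else is an involution, hence bijective.\<close>

lemma bij_renaming_apart:
  fixes V W :: "'v set"
  assumes "infinite (UNIV :: 'v set)" "finite V" "finite W"
  shows "\<exists>\<rho>. bij \<rho> \<and> \<rho> ` V \<inter> W = {}"
proof -
  have "infinite (UNIV - (V \<union> W))" using assms by simp
  then obtain U where U: "U \<subseteq> UNIV - (V \<union> W)" "finite U" "card U = card V"
    using infinite_arbitrarily_large[of _ "card V"] by metis
  then obtain h where h: "bij_betw h V U" using assms(2) finite_same_card_bij by metis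
  let ?g = "inv_into V h"
  let ?\<rho> = "\<lambda>x. if x \<in> V then h x else if x \<in> U then ?g x else x"
  have g: "bij_betw ?g U V" using h by (rule bij_betw_inv_into)
  have "?\<rho> (?\<rho> x) = x" for x
    using U(1) bij_betw_apply[OF h, of x] bij_betw_apply[OF g, of x]
      bij_betw_inv_into_left[OF h, of x] bij_betw_inv_into_right[OF h, of x] by auto
  then have "bij ?\<rho>" by (intro o_bij[of ?\<rho>]) auto
  moreover have "?\<rho> ` V \<inter> W = {}" using U(1) bij_betw_apply[OF h] by auto
  ultimately show ?thesis by blast
qed

section \<open>Rewriting\<close>

lemma wf_term_subst: "wf_term F (t \<cdot> \<sigma>) \<longleftrightarrow> wf_term F t \<and> (\<forall>x \<in> vars t. wf_term F (\<sigma> x))"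
  by (induction t) auto

lemma Nil_in_poss [simp]: "[] \<in> poss t"
  by (cases t) auto

lemma subst_replace_at:
  "p \<in> poss s \<Longrightarrow> replace_at s p t \<cdot> \<sigma> = replace_at (s \<cdot> \<sigma>) p (t \<cdot> \<sigma>)"
  by (induction s p t rule: replace_at.induct) (auto simp: map_update)

lemma poss_subst: "p \<in> poss s \<Longrightarrow> p \<in> poss (s \<cdot> \<sigma>)"
  by (induction s p rule: subt_at.induct) auto

text \<open>Positions give way to closure under arguments, so that peaks can be analysed by
  induction on terms. The next two lemmas translate back and forth.\<close>

inductive contracts :: "('f, 'v) rule \<Rightarrow> ('f, 'v) fterm \<Rightarrow> ('f, 'v) fterm \<Rightarrow> bool" for e where
  contracts_root: "contracts e (fst e \<cdot> \<sigma>) (snd e \<cdot> \<sigma>)"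
| contracts_arg: "k < length ss \<Longrightarrow> contracts e (ss ! k) t \<Longrightarrow> contracts e (Fun f ss) (Fun f (ss[k := t]))"

lemma contracts_imp_position:
  assumes "contracts e s t"
  shows "\<exists>p \<sigma>. p \<in> poss s \<and> subt_at s p = fst e \<cdot> \<sigma> \<and> t = replace_at s p (snd e \<cdot> \<sigma>)"
  using assms
proof (induction rule: contracts.induct)
  case (contracts_root \<sigma>)
  show ?case by (intro exI[of _ "[]"] exI[of _ \<sigma>]) auto
next
  case (contracts_arg k ss t f)
  then obtain p \<sigma> where "p \<in> poss (ss ! k)" "subt_at (ss ! k) p = fst e \<cdot> \<sigma>"
    "t = replace_at (ss ! k) p (snd e \<cdot> \<sigma>)" by blast
  with contracts_arg.hyps show ?case by (intro exI[of _ "k # p"] exI[of _ \<sigma>]) auto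
qed

lemma position_imp_contracts:
  "p \<in> poss s \<Longrightarrow> subt_at s p = fst e \<cdot> \<sigma> \<Longrightarrow> contracts e s (replace_at s p (snd e \<cdot> \<sigma>))"
proof (induction s p rule: subt_at.induct)
  case (1 t)
  then show ?case using contracts_root[of e \<sigma>] by simp
qed (auto intro: contracts_arg)

lemma contracts_subst: "contracts e s t \<Longrightarrow> contracts e (s \<cdot> \<sigma>) (t \<cdot> \<sigma>)"
proof (induction rule: contracts.induct)
  case (contracts_root \<tau>)
  show ?case using contracts.contracts_root[of e "\<lambda>x. \<tau> x \<cdot> \<sigma>"] by (simp add: subst_subst)
next
  case (contracts_arg k ss t f)
  then show ?case
    using contracts.contracts_arg[of k "map (\<lambda>t. t \<cdot> \<sigma>) ss" e "t \<cdot> \<sigma>" f] by (simp add: map_update)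
qed

definition wf_contracts ::
  "('f \<times> nat) set \<Rightarrow> ('f, 'v) rule \<Rightarrow> ('f, 'v) fterm \<Rightarrow> ('f, 'v) fterm \<Rightarrow> bool" where
  "wf_contracts F e s t \<longleftrightarrow> wf_term F s \<and> wf_term F t \<and> contracts e s t"

lemma step_by_wf_contracts: "step_by F R \<pi> s t \<Longrightarrow> fst (snd \<pi>) \<in> R \<and> wf_contracts F (fst (snd \<pi>)) s t"
  using position_imp_contracts[of "fst \<pi>" s "fst (snd \<pi>)" "snd (snd \<pi>)"]
  by (auto simp: step_by_def wf_contracts_def split: prod.splits)

lemma rstep_iff: "rstep F R s t \<longleftrightarrow> (\<exists>e \<in> R. wf_contracts F e s t)"
proof
  assume "\<exists>e \<in> R. wf_contracts F e s t"
  then obtain e where e: "e \<in> R" "wf_term F s" "wf_term F t" "contracts e s t"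
    by (auto simp: wf_contracts_def)
  from contracts_imp_position[OF e(4)] obtain p \<sigma>
    where "p \<in> poss s" "subt_at s p = fst e \<cdot> \<sigma>" "t = replace_at s p (snd e \<cdot> \<sigma>)" by blast
  with e have "step_by F R (p, e, \<sigma>) s t" by (auto simp: step_by_def split: prod.splits)
  then show "rstep F R s t" unfolding rstep_def by blast
qed (use step_by_wf_contracts in \<open>fastforce simp: rstep_def\<close>)

lemma wf_term_update:
  "wf_term F (Fun f ss) \<Longrightarrow> wf_term F t \<Longrightarrow> wf_term F (Fun f (ss[k := t]))"
  by (auto dest!: set_update_subset_insert[THEN subsetD])

lemma wf_contracts_arg:
  assumes "wf_term F (Fun f ss)" "k < length ss" "wf_contracts F e s t"
  shows "wf_contracts F e (Fun f (ss[k := s])) (Fun f (ss[k := t]))"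
  using assms(2,3) contracts_arg[of k "ss[k := s]" e t f] wf_term_update[OF assms(1)]
  by (simp add: wf_contracts_def del: wf_term.simps)

lemma wf_contracts_subst:
  assumes "\<And>x. wf_term F (\<sigma> x)" "wf_contracts F e s t"
  shows "wf_contracts F e (s \<cdot> \<sigma>) (t \<cdot> \<sigma>)"
  using assms by (auto simp: wf_contracts_def wf_term_subst contracts_subst)

lemma rtranclp_map:
  assumes "r\<^sup>*\<^sup>* x y" "\<And>x y. r x y \<Longrightarrow> r' (f x) (f y)"
  shows "r'\<^sup>*\<^sup>* (f x) (f y)"
  using assms(1) by (induction rule: rtranclp_induct) (auto intro: rtranclp.rtrancl_into_rtrancl assms(2))

section \<open>Linear terms and steps inside their instances\<close>

lemma occs_eq_0: "occs x t = 0 \<longleftrightarrow> x \<notin> vars t"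
  by (induction t) auto

lemma occs_nth_le: "k < length ts \<Longrightarrow> occs x (ts ! k) \<le> occs x (Fun f ts)"
  using elem_le_sum_list[of k "map (occs x) ts"] by simp

lemma occs_le_1_args:
  assumes "occs x (Fun f ts) \<le> 1" "k < length ts" "x \<in> vars (ts ! k)" "j < length ts" "j \<noteq> k"
  shows "x \<notin> vars (ts ! j)"
proof -
  have "(\<Sum>m \<in> {j, k}. occs x (ts ! m)) \<le> (\<Sum>m < length ts. occs x (ts ! m))"
    using assms by (intro sum_mono2) auto
  also have "\<dots> = occs x (Fun f ts)" by (simp add: sum_list_sum_nth atLeast0LessThan)
  finally have "occs x (ts ! j) + occs x (ts ! k) \<le> 1" using assms by simp
  moreover have "occs x (ts ! k) \<noteq> 0" using assms(3) by (simp add: occs_eq_0)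
  ultimately show ?thesis by (simp add: occs_eq_0[symmetric])
qed

lemma map_subst_update:
  assumes "occs x (Fun f ts) \<le> 1" "k < length ts" "x \<in> vars (ts ! k)"
  shows "map (\<lambda>t. t \<cdot> \<sigma>(x := y)) ts = (map (\<lambda>t. t \<cdot> \<sigma>) ts)[k := ts ! k \<cdot> \<sigma>(x := y)]"
proof (rule nth_equalityI)
  fix j assume "j < length (map (\<lambda>t. t \<cdot> \<sigma>(x := y)) ts)"
  then show "map (\<lambda>t. t \<cdot> \<sigma>(x := y)) ts ! j = (map (\<lambda>t. t \<cdot> \<sigma>) ts)[k := ts ! k \<cdot> \<sigma>(x := y)] ! j"
    using occs_le_1_args[OF assms, of j] by (cases "j = k") (auto intro!: subst_cong)
qed simp

text \<open>Follow the path to the redex through \<open>l\<close>: it ends at a function position,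
  which leads to an overlap, or it leaves \<open>l\<close> at a variable. In the second case
  linearity makes this the only occurrence of the variable, so the result is again an instance of
  \<open>l\<close>.\<close>

lemma contracts_subst_instance:
  assumes "contracts e (l \<cdot> \<sigma>) t" "\<And>x. occs x l \<le> 1"
  shows "(\<exists>p \<tau>. p \<in> fposs l \<and> subt_at l p \<cdot> \<sigma> = fst e \<cdot> \<tau> \<and> t = replace_at (l \<cdot> \<sigma>) p (snd e \<cdot> \<tau>)) \<or>
    (\<exists>x y. x \<in> vars l \<and> contracts e (\<sigma> x) y \<and> t = l \<cdot> \<sigma>(x := y))"
  using assms
proof (induction l arbitrary: t)
  case (Var x)
  then show ?case by auto
next
  case (Fun f ls)
  from Fun.prems(1) consider \<tau> where "Fun f ls \<cdot> \<sigma> = fst e \<cdot> \<tau>" "t = snd e \<cdot> \<tau>"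
    | k t' where "k < length ls" "contracts e (ls ! k \<cdot> \<sigma>) t'" "t = Fun f ((map (\<lambda>t. t \<cdot> \<sigma>) ls)[k := t'])"
    by (cases rule: contracts.cases) auto
  then show ?case
  proof cases
    case (1 \<tau>)
    then show ?thesis by (intro disjI1 exI[of _ "[]"] exI[of _ \<tau>]) (auto simp: fposs_def)
  next
    case (2 k t')
    have "occs x (ls ! k) \<le> 1" for x
      using occs_nth_le[OF 2(1), of x f] Fun.prems(2)[of x] by simp
    from Fun.IH[OF nth_mem[OF 2(1)] 2(2) this] show ?thesis
    proof (elim disjE exE conjE)
      fix p \<tau> assume "p \<in> fposs (ls ! k)" "subt_at (ls ! k) p \<cdot> \<sigma> = fst e \<cdot> \<tau>"
        "t' = replace_at (ls ! k \<cdot> \<sigma>) p (snd e \<cdot> \<tau>)"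
      with 2 show ?thesis by (intro disjI1 exI[of _ "k # p"] exI[of _ \<tau>]) (auto simp: fposs_def)
    next
      fix x y assume x: "x \<in> vars (ls ! k)" "contracts e (\<sigma> x) y" "t' = ls ! k \<cdot> \<sigma>(x := y)"
      have "t = Fun f ls \<cdot> \<sigma>(x := y)"
        using map_subst_update[OF Fun.prems(2) 2(1) x(1)] 2 x by simp
      moreover have "x \<in> vars (Fun f ls)" using 2(1) x(1) by auto
      ultimately show ?thesis using x(2) by blast
    qed
  qed
qed

lemma wf_contracts_args:
  assumes "wf_term F (Fun f ts)" "length us = length ts"
    and "\<And>k. k < length ts \<Longrightarrow> (wf_contracts F e)\<^sup>*\<^sup>* (ts ! k) (us ! k)"
  shows "(wf_contracts F e)\<^sup>*\<^sup>* (Fun f ts) (Fun f us)"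
proof -
  have wf: "wf_term F t \<Longrightarrow> wf_term F u" if "(wf_contracts F e)\<^sup>*\<^sup>* t u" for t u
    using that by (induction rule: rtranclp_induct) (auto simp: wf_contracts_def)
  have "n \<le> length ts \<Longrightarrow> (wf_contracts F e)\<^sup>*\<^sup>* (Fun f ts) (Fun f (take n us @ drop n ts))" for n
  proof (induction n)
    case (Suc n)
    let ?ss = "take n us @ drop n ts"
    have wf_ss: "wf_term F (Fun f ?ss)" using wf[OF Suc.IH] Suc.prems assms(1) by simp
    have ss: "?ss[n := ts ! n] = ?ss" "?ss[n := us ! n] = take (Suc n) us @ drop (Suc n) ts"
      using Suc.prems assms(2)
      by (auto simp: list_update_append take_Suc_conv_app_nth Cons_nth_drop_Suc[symmetric])
    have "(wf_contracts F e)\<^sup>*\<^sup>* (Fun f (?ss[n := ts ! n])) (Fun f (?ss[n := us ! n]))"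
      by (rule rtranclp_map[OF assms(3), of _ _ "\<lambda>t. Fun f (?ss[n := t])"])
        (use Suc.prems assms(2) wf_contracts_arg[OF wf_ss] in auto)
    with Suc ss show ?case by simp
  qed simp
  from this[of "length ts"] show ?thesis using assms(2) by simp
qed

text \<open>One step for each occurrence of \<open>x\<close> in \<open>t\<close>, in the copy of
  \<sigma> x that stands there.\<close>

lemma wf_contracts_subst_update:
  assumes "wf_contracts F e (\<sigma> x) y" "wf_term F (t \<cdot> \<sigma>)"
  shows "(wf_contracts F e)\<^sup>*\<^sup>* (t \<cdot> \<sigma>) (t \<cdot> \<sigma>(x := y))"
  using assms(2)
proof (induction t)
  case (Var z)
  then show ?case using assms(1) by auto
next
  case (Fun f ts)
  then show ?case using wf_contracts_args[of F f "map (\<lambda>t. t \<cdot> \<sigma>) ts" "map (\<lambda>t. t \<cdot> \<sigma>(x := y)) ts" e]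
    by (simp del: fun_upd_apply)
qed

lemma wf_contracts_subst_update_linear:
  assumes "wf_contracts F e (\<sigma> x) y" "wf_term F (t \<cdot> \<sigma>)" "occs x t \<le> 1"
  shows "(wf_contracts F e)\<^sup>=\<^sup>= (t \<cdot> \<sigma>) (t \<cdot> \<sigma>(x := y))"
  using assms(2,3)
proof (induction t)
  case (Var z)
  then show ?case using assms(1) by auto
next
  case (Fun f ts)
  show ?case
  proof (cases "x \<in> vars (Fun f ts)")
    case False
    then have "Fun f ts \<cdot> \<sigma> = Fun f ts \<cdot> \<sigma>(x := y)" by (intro subst_cong) auto
    then show ?thesis by (simp del: fun_upd_apply)
  next
    case True
    then obtain k where k: "k < length ts" "x \<in> vars (ts ! k)" by (auto simp: in_set_conv_nth)
    from k(1) have IH: "(wf_contracts F e)\<^sup>=\<^sup>= (ts ! k \<cdot> \<sigma>) (ts ! k \<cdot> \<sigma>(x := y))"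
      using Fun.prems occs_nth_le[OF k(1), of x f] by (intro Fun.IH) auto
    let ?ts = "map (\<lambda>t. t \<cdot> \<sigma>) ts"
    have u: "Fun f ts \<cdot> \<sigma>(x := y) = Fun f (?ts[k := ts ! k \<cdot> \<sigma>(x := y)])"
      using map_subst_update[OF Fun.prems(2) k] by simp
    have t: "Fun f ts \<cdot> \<sigma> = Fun f (?ts[k := ts ! k \<cdot> \<sigma>])"
      using list_update_id[of ?ts k] k(1) by simp
    have wf: "wf_term F (Fun f ?ts)" using Fun.prems(1) by simp
    show ?thesis unfolding t u using IH wf_contracts_arg[OF wf, of k e] k(1) by auto
  qed
qed

section \<open>Labels\<close>

text \<open>
  Besides the label formed by its source and the index of its rule, a step may be given any larger
  label: this turns weak decrease into the equality demanded by decreasing diagrams.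
\<close>

definition dup_reach ::
  "('f \<times> nat) set \<Rightarrow> ('f, 'v) trs \<Rightarrow> ('f, 'v) fterm \<Rightarrow> ('f, 'v) fterm \<Rightarrow> bool" where
  "dup_reach F R s t \<longleftrightarrow>
     (\<exists>a b. (rstep F R)\<^sup>*\<^sup>* s a \<and> rstep F (dup_rules R) a b \<and> (rstep F R)\<^sup>*\<^sup>* b t)"

definition label_less ::
  "('f \<times> nat) set \<Rightarrow> ('f, 'v) trs \<Rightarrow> ('f, 'v) fterm \<times> nat \<Rightarrow> ('f, 'v) fterm \<times> nat \<Rightarrow> bool" where
  "label_less F R k l \<longleftrightarrow> dup_reach F R (fst l) (fst k) \<or>
     (rstep F R)\<^sup>*\<^sup>* (fst l) (fst k) \<and> snd k < snd l"

definition label_le ::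
  "('f \<times> nat) set \<Rightarrow> ('f, 'v) trs \<Rightarrow> ('f, 'v) fterm \<times> nat \<Rightarrow> ('f, 'v) fterm \<times> nat \<Rightarrow> bool" where
  "label_le F R k l \<longleftrightarrow> dup_reach F R (fst l) (fst k) \<or>
     (rstep F R)\<^sup>*\<^sup>* (fst l) (fst k) \<and> snd k \<le> snd l"

lemma rstep_mono: "R \<subseteq> S \<Longrightarrow> rstep F R s t \<Longrightarrow> rstep F S s t"
  unfolding rstep_iff by blast

lemma dup_reach_imp_reach: "dup_reach F R s t \<Longrightarrow> (rstep F R)\<^sup>*\<^sup>* s t"
proof -
  assume "dup_reach F R s t"
  then obtain a b where "(rstep F R)\<^sup>*\<^sup>* s a" "rstep F (dup_rules R) a b" "(rstep F R)\<^sup>*\<^sup>* b t"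
    by (auto simp: dup_reach_def)
  moreover from this(2) have "rstep F R a b" by (rule rstep_mono[rotated]) (auto simp: dup_rules_def)
  ultimately show ?thesis by (meson rtranclp.rtrancl_into_rtrancl rtranclp_trans)
qed

lemma reach_dup_reach: "(rstep F R)\<^sup>*\<^sup>* s t \<Longrightarrow> dup_reach F R t u \<Longrightarrow> dup_reach F R s u"
  and dup_reach_reach: "dup_reach F R s t \<Longrightarrow> (rstep F R)\<^sup>*\<^sup>* t u \<Longrightarrow> dup_reach F R s u"
  unfolding dup_reach_def by (meson rtranclp_trans)+

lemma label_less_le_trans: "label_less F R j k \<Longrightarrow> label_le F R k l \<Longrightarrow> label_less F R j l"
  unfolding label_less_def label_le_def
  by (meson dup_reach_imp_reach dup_reach_reach reach_dup_reach rtranclp_trans less_le_trans)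

lemma label_le_trans: "label_le F R j k \<Longrightarrow> label_le F R k l \<Longrightarrow> label_le F R j l"
  unfolding label_le_def
  by (meson dup_reach_imp_reach dup_reach_reach reach_dup_reach rtranclp_trans order_trans)

lemma label_less_imp_le: "label_less F R k l \<Longrightarrow> label_le F R k l"
  by (auto simp: label_less_def label_le_def)

lemma transp_label_less: "transp (label_less F R)"
  by (intro transpI) (blast intro: label_less_le_trans label_less_imp_le)

text \<open>Every step is duplicating or not, and non-duplicating steps next to a factor of the
  relative relation are absorbed by it. So a rewrite sequence with at least one duplicating step is
  a nonempty sequence of such factors.\<close>

lemma wfp_dup_reach:
  assumes "rel_terminating F (dup_rules R) (nondup_rules R)"
  shows "wfp (\<lambda>t s. dup_reach F R s t)"
proof -
  let ?N = "rstep F (nondup_rules R)" and ?D = "rstep F (dup_rules R)"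
  let ?r = "?N\<^sup>*\<^sup>* OO ?D OO ?N\<^sup>*\<^sup>*"
  have N: "?r\<^sup>+\<^sup>+ s u" if "?N s t" "?r\<^sup>+\<^sup>+ t u" for s t u
  proof -
    from tranclpD[OF that(2)] obtain v where v: "?r t v" "?r\<^sup>*\<^sup>* v u" by blast
    from v(1) that(1) have "?r s v" by (auto intro: converse_rtranclp_into_rtranclp)
    then show ?thesis using v(2) by (rule rtranclp_into_tranclp2)
  qed
  have N': "?r\<^sup>+\<^sup>+ s u" if "?r\<^sup>+\<^sup>+ s t" "?N t u" for s t u
    using that(1)
  proof (cases rule: tranclp.cases)
    case r_into_trancl
    with that(2) have "?r s u" by (auto intro: rtranclp.rtrancl_into_rtrancl)
    then show ?thesis by blast
  next
    case (trancl_into_trancl v)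
    with that(2) have "?r v u" by (auto intro: rtranclp.rtrancl_into_rtrancl)
    with trancl_into_trancl(1) show ?thesis by (rule tranclp.trancl_into_trancl)
  qed
  have D: "?r s t" if "?D s t" for s t using that by blast
  have split: "?N s t \<or> ?D s t" if "rstep F R s t" for s t
    using that unfolding rstep_iff dup_rules_def nondup_rules_def by blast
  have "?r\<^sup>+\<^sup>+ s t" if "dup_reach F R s t" for s t
  proof -
    from that obtain a b where ab: "(rstep F R)\<^sup>*\<^sup>* s a" "?D a b" "(rstep F R)\<^sup>*\<^sup>* b t"
      by (auto simp: dup_reach_def)
    from ab(3) have "?r\<^sup>+\<^sup>+ a t"
    proof (induction rule: rtranclp_induct)
      case base
      then show ?case using D[OF ab(2)] by blast
    next
      case (step y z)
      from split[OF step(2)] show ?case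
        using N'[OF step.IH] tranclp.trancl_into_trancl[of ?r, OF step.IH D] by blast
    qed
    with ab(1) show ?thesis
    proof (induction rule: converse_rtranclp_induct)
      case (step y z)
      from split[OF step(1)] show ?case
        using N[OF _ step.IH[OF step.prems]] tranclp_into_tranclp2[of ?r, OF D step.IH[OF step.prems]]
        by blast
    qed
  qed
  then have "(\<lambda>t s. dup_reach F R s t) \<le> (?r\<inverse>\<inverse>)\<^sup>+\<^sup>+" by (auto simp: tranclp_converse)
  moreover have "wfp ((?r\<inverse>\<inverse>)\<^sup>+\<^sup>+)"
    using assms unfolding rel_terminating_def by (rule wfp_tranclp)
  ultimately show ?thesis using wfp_subset by blast
qed

text \<open>Sources are compared weakly by reachability, a quasi-order in which distinct terms may
  reach each other, so this is not a plain lexicographic product.\<close>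

lemma wfp_label_less:
  assumes "rel_terminating F (dup_rules R) (nondup_rules R)"
  shows "wfp (label_less F R)"
proof (rule wfpUNIVI)
  fix P and l :: "('a, 'b) fterm \<times> nat"
  assume *: "\<forall>l. (\<forall>k. label_less F R k l \<longrightarrow> P k) \<longrightarrow> P l"
  \<comment> \<open>Generalized to all sources \<open>s\<close> reachable from \<open>a\<close>: a
    label that moves weakly to another source stays covered by the same \<open>a\<close>, and the
    inner induction on the index continues; after a duplicating step the outer induction takes over
    with a new \<open>a\<close>.\<close>
  have "(rstep F R)\<^sup>*\<^sup>* a s \<Longrightarrow> P (s, n)" for a s n
    using wfp_dup_reach[OF assms]
  proof (induction a arbitrary: s n rule: wfp_induct_rule)
    case (less a)
    note IH = less.IH
    from less.prems show ?case
    proof (induction n arbitrary: s rule: less_induct)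
      case (less n)
      have "P (t, m)" if "label_less F R (t, m) (s, n)" for t m
      proof (cases "dup_reach F R s t")
        case True
        with less.prems have "dup_reach F R a t" by (rule reach_dup_reach)
        with IH show ?thesis by blast
      next
        case False
        with that less show ?thesis by (auto simp: label_less_def intro: rtranclp_trans)
      qed
      with * show ?case by (metis prod.collapse)
    qed
  qed
  from this[of "fst l" "fst l" "snd l"] show "P l" by simp
qed

section \<open>Labelled steps and decreasing joins\<close>

definition labeled_step ::
  "('f \<times> nat) set \<Rightarrow> ('f, 'v) trs \<Rightarrow> (('f, 'v) rule \<Rightarrow> nat) \<Rightarrow> ('f, 'v) fterm \<times> nat \<Rightarrow>
   ('f, 'v) fterm \<Rightarrow> ('f, 'v) fterm \<Rightarrow> bool" where
  "labeled_step F R i l s t \<longleftrightarrow> (\<exists>e \<in> R. wf_contracts F e s t \<and> label_le F R (s, i e) l)"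

definition conv_below where
  "conv_below F R i P = (\<lambda>x y. \<exists>l. P l \<and> (labeled_step F R i l x y \<or> labeled_step F R i l y x))\<^sup>*\<^sup>*"

text \<open>The peak condition of \<open>decreasing_diagrams\<close>, with \<open>k\<close> the
  label of the step to \<open>t\<close> and \<open>l\<close> that of the step to
  \<open>u\<close>.\<close>

definition decreasing_join where
  "decreasing_join F R i k l t u \<longleftrightarrow> (\<exists>t' t'' u'' u'.
     conv_below F R i (\<lambda>j. label_less F R j k) t t' \<and> (labeled_step F R i l)\<^sup>=\<^sup>= t' t'' \<and>
     conv_below F R i (\<lambda>j. label_less F R j k \<or> label_less F R j l) t'' u'' \<and>
     (labeled_step F R i k)\<^sup>=\<^sup>= u' u'' \<and> conv_below F R i (\<lambda>j. label_less F R j l) u' u)"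

lemma conv_below_refl [simp]: "conv_below F R i P x x"
  by (simp add: conv_below_def)

lemma conv_below_mono:
  assumes "conv_below F R i P x y" "\<And>l. P l \<Longrightarrow> Q l"
  shows "conv_below F R i Q x y"
  using assms(1) unfolding conv_below_def
  by (rule rtranclp_mono[THEN predicate2D, rotated]) (use assms(2) in blast)

lemma conv_below_sym: "conv_below F R i P x y \<Longrightarrow> conv_below F R i P y x"
  unfolding conv_below_def by (rule sympD[OF symp_rtranclp]) (auto intro: sympI)

lemma decreasing_join_sym: "decreasing_join F R i k l t u \<Longrightarrow> decreasing_join F R i l k u t"
  unfolding decreasing_join_def
  by (elim exE conjE, intro exI conjI)
    (assumption | erule conv_below_sym | erule conv_below_mono[OF conv_below_sym], blast)+

lemma labeled_step_mono: "labeled_step F R i k s t \<Longrightarrow> label_le F R k l \<Longrightarrow> labeled_step F R i l s t"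
  unfolding labeled_step_def by (blast intro: label_le_trans)

text \<open>Serves to pass from the own labels of the two steps of a peak, formed by source and
  index, to the larger labels that they may have been given.\<close>

lemma decreasing_join_mono:
  assumes "decreasing_join F R i k l t u" "label_le F R k k'" "label_le F R l l'"
  shows "decreasing_join F R i k' l' t u"
proof -
  from assms(1) obtain t' t'' u'' u' where
    d: "conv_below F R i (\<lambda>j. label_less F R j k) t t'" "(labeled_step F R i l)\<^sup>=\<^sup>= t' t''"
     "conv_below F R i (\<lambda>j. label_less F R j k \<or> label_less F R j l) t'' u''"
     "(labeled_step F R i k)\<^sup>=\<^sup>= u' u''" "conv_below F R i (\<lambda>j. label_less F R j l) u' u"
    unfolding decreasing_join_def by blast
  show ?thesis
    unfolding decreasing_join_def
  proof (intro exI conjI)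
    show "conv_below F R i (\<lambda>j. label_less F R j k') t t'"
      using d(1) by (rule conv_below_mono) (rule label_less_le_trans[OF _ assms(2)])
    show "(labeled_step F R i l')\<^sup>=\<^sup>= t' t''" using d(2) labeled_step_mono[OF _ assms(3)] by blast
    show "conv_below F R i (\<lambda>j. label_less F R j k' \<or> label_less F R j l') t'' u''"
      using d(3) by (rule conv_below_mono) (use label_less_le_trans assms(2,3) in blast)
    show "(labeled_step F R i k')\<^sup>=\<^sup>= u' u''" using d(4) labeled_step_mono[OF _ assms(2)] by blast
    show "conv_below F R i (\<lambda>j. label_less F R j l') u' u"
      using d(5) by (rule conv_below_mono) (rule label_less_le_trans[OF _ assms(3)])
  qed
qed

text \<open>Contexts and substitutions enter alike as maps \<open>C\<close> compatible with
  contraction. They keep the rule of a step, hence its index and whether it is duplicating, and they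
  act on the sources in labels, so all comparisons of labels carry over.\<close>

lemma decreasing_join_map:
  assumes C: "\<And>e s t. wf_contracts F e s t \<Longrightarrow> wf_contracts F e (C s) (C t)"
    and join: "decreasing_join F R i k l t u"
  shows "decreasing_join F R i (apfst C k) (apfst C l) (C t) (C u)"
proof -
  have rstep: "rstep F S s t \<Longrightarrow> rstep F S (C s) (C t)" for S s t
    unfolding rstep_iff using C by blast
  have reach: "(rstep F R)\<^sup>*\<^sup>* s t \<Longrightarrow> (rstep F R)\<^sup>*\<^sup>* (C s) (C t)" for s t
    by (erule rtranclp_map) (rule rstep)
  have dup: "dup_reach F R s t \<Longrightarrow> dup_reach F R (C s) (C t)" for s t
    unfolding dup_reach_def using reach rstep by blast
  have less: "label_less F R k l \<Longrightarrow> label_less F R (apfst C k) (apfst C l)" for k l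
    using reach dup by (auto simp: label_less_def)
  have le: "label_le F R k l \<Longrightarrow> label_le F R (apfst C k) (apfst C l)" for k l
    using reach dup by (auto simp: label_le_def)
  have step: "labeled_step F R i (apfst C l) (C s) (C t)" if "labeled_step F R i l s t" for l s t
  proof -
    from that obtain e where e: "e \<in> R" "wf_contracts F e s t" "label_le F R (s, i e) l"
      unfolding labeled_step_def by blast
    with C[OF e(2)] le[OF e(3)] show ?thesis unfolding labeled_step_def by auto
  qed
  have conv: "conv_below F R i Q (C s) (C t)"
    if "conv_below F R i P s t" "\<And>l. P l \<Longrightarrow> Q (apfst C l)" for P Q s t
    using that(1) unfolding conv_below_def
    by (rule rtranclp_map) (use step that(2) in blast)
  from join obtain t' t'' u'' u' where
    d: "conv_below F R i (\<lambda>j. label_less F R j k) t t'" "(labeled_step F R i l)\<^sup>=\<^sup>= t' t''"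
     "conv_below F R i (\<lambda>j. label_less F R j k \<or> label_less F R j l) t'' u''"
     "(labeled_step F R i k)\<^sup>=\<^sup>= u' u''" "conv_below F R i (\<lambda>j. label_less F R j l) u' u"
    unfolding decreasing_join_def by blast
  show ?thesis
    unfolding decreasing_join_def
  proof (intro exI conjI)
    show "conv_below F R i (\<lambda>j. label_less F R j (apfst C k)) (C t) (C t')"
      using d(1) less by (rule conv)
    show "(labeled_step F R i (apfst C l))\<^sup>=\<^sup>= (C t') (C t'')" using d(2) step by blast
    show "conv_below F R i (\<lambda>j. label_less F R j (apfst C k) \<or> label_less F R j (apfst C l))
        (C t'') (C u'')"
      using d(3) by (rule conv) (use less in blast)
    show "(labeled_step F R i (apfst C k))\<^sup>=\<^sup>= (C u') (C u'')" using d(4) step by blast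
    show "conv_below F R i (\<lambda>j. label_less F R j (apfst C l)) (C u') (C u)"
      using d(5) less by (rule conv)
  qed
qed

text \<open>Here \<open>s\<close> is the source of the peak: \<open>P\<close> bounds the indices,
  and \<open>Q\<close> bounds the labels that arise from them once the sources are known to be
  reachable from \<open>s\<close>. The second conclusion lets the segments of a diagram be treated
  in succession.\<close>

lemma conversion_conv_below:
  assumes "conversion F R a c b" "(rstep F R)\<^sup>*\<^sup>* s a"
    and "\<forall>v \<in> set (map snd c). (rstep F R)\<^sup>*\<^sup>* s v"
    and "\<forall>(\<pi>, v) \<in> set c. P (rule_label i \<pi>)"
    and PQ: "\<And>v n. (rstep F R)\<^sup>*\<^sup>* s v \<Longrightarrow> P n \<Longrightarrow> Q (v, n)"
  shows "conv_below F R i Q a b \<and> (rstep F R)\<^sup>*\<^sup>* s b"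
proof -
  have step: "labeled_step F R i (x, rule_label i \<pi>) x y" if "step_by F R \<pi> x y" for \<pi> x y
    unfolding labeled_step_def using step_by_wf_contracts[OF that]
    by (auto simp: label_le_def rule_label_def)
  show ?thesis
    using assms(1-4)
  proof (induction rule: conversion.induct)
    case (conv_nil s)
    then show ?case by simp
  next
    case (conv_forward \<pi> x y c b)
    then have "Q (x, rule_label i \<pi>)" using PQ by simp
    with step[OF conv_forward(1)] conv_forward show ?case
      unfolding conv_below_def by (auto intro: converse_rtranclp_into_rtranclp)
  next
    case (conv_backward \<pi> y x c b)
    then have "Q (y, rule_label i \<pi>)" using PQ by simp
    with step[OF conv_backward(1)] conv_backward show ?case
      unfolding conv_below_def by (auto intro: converse_rtranclp_into_rtranclp)
  qed
qed

lemma local_diagram_decreasing_join: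
  assumes "local_diagram F R t D u" "fan_property F R s t D" "decreasing_diagram i \<alpha> \<beta> D"
  shows "decreasing_join F R i (s, \<alpha>) (s, \<beta>) t u"
proof -
  obtain c\<^sub>1 c\<^sub>2 c\<^sub>3 c\<^sub>4 c\<^sub>5 where D: "D = (c\<^sub>1, c\<^sub>2, c\<^sub>3, c\<^sub>4, c\<^sub>5)" by (cases D)
  let ?reach = "(rstep F R)\<^sup>*\<^sup>*"
  from assms(1) obtain t' t'' u'' u' where
    c: "conversion F R t c\<^sub>1 t'" "opt_forward F R t' c\<^sub>2 t''" "conversion F R t'' c\<^sub>3 u''"
      "opt_backward F R u'' c\<^sub>4 u'" "conversion F R u' c\<^sub>5 u"
    unfolding local_diagram_def D by auto
  have fan: "?reach s t" "\<forall>v \<in> set (map snd c\<^sub>1). ?reach s v" "\<forall>v \<in> set (map snd c\<^sub>2). ?reach s v"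
    "\<forall>v \<in> set (map snd c\<^sub>3). ?reach s v" "\<forall>v \<in> set (map snd c\<^sub>4). ?reach s v"
    "\<forall>v \<in> set (map snd c\<^sub>5). ?reach s v"
    using assms(2) unfolding fan_property_def D by auto
  have dec: "\<forall>(\<pi>, v) \<in> set c\<^sub>1. rule_label i \<pi> < \<alpha>" "\<forall>(\<pi>, v) \<in> set c\<^sub>2. rule_label i \<pi> \<le> \<beta>"
    "\<forall>(\<pi>, v) \<in> set c\<^sub>3. rule_label i \<pi> < \<alpha> \<or> rule_label i \<pi> < \<beta>"
    "\<forall>(\<pi>, v) \<in> set c\<^sub>4. rule_label i \<pi> \<le> \<alpha>" "\<forall>(\<pi>, v) \<in> set c\<^sub>5. rule_label i \<pi> < \<beta>"
    using assms(3) unfolding decreasing_diagram_def D by auto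
  have less: "label_less F R (v, m) (s, n)" if "?reach s v" "m < n" for v m n
    using that by (simp add: label_less_def)
  have step: "labeled_step F R i (s, n) x y" if "step_by F R \<pi> x y" "?reach s x" "rule_label i \<pi> \<le> n"
    for \<pi> x y n
    unfolding labeled_step_def using step_by_wf_contracts[OF that(1)] that(2,3)
    by (auto simp: label_le_def rule_label_def)
  have 1: "conv_below F R i (\<lambda>j. label_less F R j (s, \<alpha>)) t t'" "?reach s t'"
    using conversion_conv_below[where P = "\<lambda>n. n < \<alpha>" and Q = "\<lambda>j. label_less F R j (s, \<alpha>)",
        OF c(1) fan(1,2) dec(1)] less by auto
  have 2: "(labeled_step F R i (s, \<beta>))\<^sup>=\<^sup>= t' t''" "?reach s t''"
    using c(2) step[of _ t' t'' \<beta>] 1(2) fan(3) dec(2) by (auto simp: opt_forward_def)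
  have 3: "conv_below F R i (\<lambda>j. label_less F R j (s, \<alpha>) \<or> label_less F R j (s, \<beta>)) t'' u''"
    "?reach s u''"
    using conversion_conv_below[where P = "\<lambda>n. n < \<alpha> \<or> n < \<beta>" and Q = "\<lambda>j. label_less F R j (s, \<alpha>) \<or> label_less F R j (s, \<beta>)",
        OF c(3) 2(2) fan(4) dec(3)] less by auto
  have 4: "(labeled_step F R i (s, \<alpha>))\<^sup>=\<^sup>= u' u''" "?reach s u'"
    using c(4) step[of _ u' u'' \<alpha>] 3(2) fan(5) dec(4) by (auto simp: opt_backward_def)
  have 5: "conv_below F R i (\<lambda>j. label_less F R j (s, \<beta>)) u' u"
    using conversion_conv_below[where P = "\<lambda>n. n < \<beta>" and Q = "\<lambda>j. label_less F R j (s, \<beta>)",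
        OF c(5) 4(2) fan(6) dec(5)] less by auto
  show ?thesis unfolding decreasing_join_def using 1(1) 2(1) 3(1) 4(1) 5 by blast
qed

section \<open>Local peaks\<close>

lemma vars_subt_at: "p \<in> poss t \<Longrightarrow> vars (subt_at t p) \<subseteq> vars t"
  by (induction t p rule: subt_at.induct) fastforce+

text \<open>It suffices to rename \<open>e\<^sub>1\<close>. The substitution \<theta> acts as
  \<sigma> on the variables of \<open>e\<^sub>2\<close> and as \<tau>, transported along the
  renaming, elsewhere. It unifies the overlap, and the factor \<delta> recovers \<theta> on every
  variable, also on those that occur only in right-hand sides.\<close>

lemma critical_peak_instance:
  fixes e\<^sub>1 e\<^sub>2 :: "('f, 'v) rule"
  assumes "infinite (UNIV :: 'v set)" "e\<^sub>1 \<in> R" "e\<^sub>2 \<in> R" "p \<in> fposs (fst e\<^sub>2)"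
    and unif: "subt_at (fst e\<^sub>2) p \<cdot> \<sigma> = fst e\<^sub>1 \<cdot> \<tau>"
  shows "\<exists>t s u \<delta>. critical_peak R e\<^sub>1 e\<^sub>2 t s u \<and> s \<cdot> \<delta> = fst e\<^sub>2 \<cdot> \<sigma> \<and>
    t \<cdot> \<delta> = replace_at (fst e\<^sub>2 \<cdot> \<sigma>) p (snd e\<^sub>1 \<cdot> \<tau>) \<and> u \<cdot> \<delta> = snd e\<^sub>2 \<cdot> \<sigma>"
proof -
  obtain \<rho> :: "'v \<Rightarrow> 'v" where \<rho>: "bij \<rho>" "\<rho> ` vars_rule e\<^sub>1 \<inter> vars_rule e\<^sub>2 = {}"
    using bij_renaming_apart[OF assms(1), of "vars_rule e\<^sub>1" "vars_rule e\<^sub>2"] by (auto simp: vars_rule_def)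
  let ?e = "rename_rule \<rho> e\<^sub>1"
  define \<theta> where "\<theta> = (\<lambda>x. if x \<in> vars_rule e\<^sub>2 then \<sigma> x else \<tau> (inv \<rho> x))"
  have inv: "inv \<rho> (\<rho> x) = x" for x using \<rho>(1) by (simp add: bij_is_inj)
  have e1: "t \<cdot> (Var \<circ> \<rho>) \<cdot> \<theta> = t \<cdot> \<tau>" if "vars t \<subseteq> vars_rule e\<^sub>1" for t
    unfolding subst_subst using that \<rho>(2) by (intro subst_cong) (auto simp: \<theta>_def inv)
  have e2: "t \<cdot> \<theta> = t \<cdot> \<sigma>" if "vars t \<subseteq> vars_rule e\<^sub>2" for t
    using that by (intro subst_cong) (auto simp: \<theta>_def)
  have p: "p \<in> poss (fst e\<^sub>2)" using assms(4) by (simp add: fposs_def)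
  have "fst ?e \<cdot> \<theta> = subt_at (fst e\<^sub>2) p \<cdot> \<theta>"
    using e1[of "fst e\<^sub>1"] e2[of "subt_at (fst e\<^sub>2) p"] vars_subt_at[OF p] unif
    by (simp add: rename_rule_def vars_rule_def le_supI1)
  then obtain \<mu> where \<mu>: "is_mgu \<mu> (fst ?e) (subt_at (fst e\<^sub>2) p)" using is_mgu_exists by blast
  with \<open>fst ?e \<cdot> \<theta> = _\<close> obtain \<delta> where "\<And>x. \<theta> x = \<mu> x \<cdot> \<delta>" unfolding is_mgu_def by blast
  then have \<delta>: "t \<cdot> \<mu> \<cdot> \<delta> = t \<cdot> \<theta>" for t
    unfolding subst_subst by (intro subst_cong) simp
  have "vars_rule ?e = \<rho> ` vars_rule e\<^sub>1"
    by (auto simp: vars_rule_def rename_rule_def vars_subst)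
  with \<rho>(2) \<mu> assms(4) have "critical_overlap ?e p e\<^sub>2 \<mu>" by (simp add: critical_overlap_def)
  moreover have "variant_of ?e e\<^sub>1" using \<rho>(1) by (auto simp: variant_of_def)
  moreover have "variant_of e\<^sub>2 e\<^sub>2"
    unfolding variant_of_def by (intro exI[of _ id]) (simp add: rename_rule_def)
  ultimately have "critical_peak R e\<^sub>1 e\<^sub>2 (replace_at (fst e\<^sub>2 \<cdot> \<mu>) p (snd ?e \<cdot> \<mu>)) (fst e\<^sub>2 \<cdot> \<mu>) (snd e\<^sub>2 \<cdot> \<mu>)"
    unfolding critical_peak_def using assms(2,3)
    by (intro conjI exI[of _ "fst ?e"] exI[of _ "snd ?e"] exI[of _ "fst e\<^sub>2"] exI[of _ "snd e\<^sub>2"]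
        exI[of _ p] exI[of _ \<mu>]) auto
  moreover have "replace_at (fst e\<^sub>2 \<cdot> \<mu>) p (snd ?e \<cdot> \<mu>) \<cdot> \<delta> = replace_at (fst e\<^sub>2 \<cdot> \<sigma>) p (snd e\<^sub>1 \<cdot> \<tau>)"
    using subst_replace_at[OF poss_subst[OF p]] e1[of "snd e\<^sub>1"] e2[of "fst e\<^sub>2"] \<delta>
    by (auto simp: vars_rule_def rename_rule_def)
  moreover have "fst e\<^sub>2 \<cdot> \<mu> \<cdot> \<delta> = fst e\<^sub>2 \<cdot> \<sigma>" "snd e\<^sub>2 \<cdot> \<mu> \<cdot> \<delta> = snd e\<^sub>2 \<cdot> \<sigma>"
    using e2 \<delta> by (auto simp: vars_rule_def)
  ultimately show ?thesis by blast
qed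

lemma labeled_stepI:
  "e \<in> R \<Longrightarrow> wf_contracts F e s t \<Longrightarrow> (rstep F R)\<^sup>*\<^sup>* a s \<Longrightarrow> labeled_step F R i (a, i e) s t"
  by (auto simp: labeled_step_def label_le_def)

text \<open>Both sides meet in the right-hand side of \<open>e\<^sub>2\<close> with \<open>y\<close>
  substituted for \<open>x\<close>. On the left, again an instance of the left-hand side, one step
  with \<open>e\<^sub>2\<close> leads there. On the right, one step with \<open>e\<^sub>1\<close> is
  needed per occurrence of \<open>x\<close>, and a non-duplicating rule with linear left-hand side
  has at most one.\<close>

lemma variable_peak_decreasing_join:
  assumes "e\<^sub>1 \<in> R" "e\<^sub>2 \<in> R"
    and linear: "occs x (fst e\<^sub>2) \<le> 1" and x: "x \<in> vars (fst e\<^sub>2)" "contracts e\<^sub>1 (\<sigma> x) y"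
    and wf: "wf_term F (fst e\<^sub>2 \<cdot> \<sigma>)" "wf_term F (fst e\<^sub>2 \<cdot> \<sigma>(x := y))" "wf_term F (snd e\<^sub>2 \<cdot> \<sigma>)"
  shows "decreasing_join F R i (fst e\<^sub>2 \<cdot> \<sigma>, i e\<^sub>1) (fst e\<^sub>2 \<cdot> \<sigma>, i e\<^sub>2)
    (fst e\<^sub>2 \<cdot> \<sigma>(x := y)) (snd e\<^sub>2 \<cdot> \<sigma>)"
proof -
  let ?s = "fst e\<^sub>2 \<cdot> \<sigma>" and ?t = "fst e\<^sub>2 \<cdot> \<sigma>(x := y)" and ?u = "snd e\<^sub>2 \<cdot> \<sigma>"
    and ?v = "snd e\<^sub>2 \<cdot> \<sigma>(x := y)"
  let ?reach = "(rstep F R)\<^sup>*\<^sup>*"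
  have y: "wf_term F y" using wf(2) x(1) by (force simp: wf_term_subst)
  then have xy: "wf_contracts F e\<^sub>1 (\<sigma> x) y"
    using x wf(1) by (auto simp: wf_contracts_def wf_term_subst)
  have "wf_term F ?v" using wf(3) y by (auto simp: wf_term_subst)
  then have tv: "wf_contracts F e\<^sub>2 ?t ?v" using wf(2) by (simp add: wf_contracts_def contracts_root)
  have su: "wf_contracts F e\<^sub>2 ?s ?u" using wf by (simp add: wf_contracts_def contracts_root)
  have reach: "?reach a b" if "(wf_contracts F e\<^sub>1)\<^sup>*\<^sup>* a b" for a b
    using that by (rule rtranclp_mono[THEN predicate2D, rotated]) (use assms(1) rstep_iff in blast)
  have "?reach ?s ?t" by (rule reach[OF wf_contracts_subst_update[OF xy wf(1)]])
  then have t: "labeled_step F R i (?s, i e\<^sub>2) ?t ?v" by (rule labeled_stepI[OF assms(2) tv])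
  have "?reach ?s ?u" using su assms(2) rstep_iff by blast
  show ?thesis
  proof (cases "duplicating e\<^sub>2")
    case False
    then have "occs x (snd e\<^sub>2) \<le> 1" using linear by (auto simp: duplicating_def not_less intro: order_trans)
    from wf_contracts_subst_update_linear[OF xy wf(3) this]
    have "(labeled_step F R i (?s, i e\<^sub>1))\<^sup>=\<^sup>= ?u ?v"
      using labeled_stepI[OF assms(1) _ \<open>?reach ?s ?u\<close>] by auto
    with t show ?thesis unfolding decreasing_join_def
      by (intro exI[of _ ?t] exI[of _ ?v] exI[of _ ?u]) auto
  next
    case True
    \<comment> \<open>All steps from \<open>?u\<close> to \<open>?v\<close> start at terms that lie strictly below \<open>?s\<close>.\<close>
    then have "rstep F (dup_rules R) ?s ?u"
      unfolding rstep_iff dup_rules_def using su assms(2) by blast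
    then have dup: "dup_reach F R ?s a" if "?reach ?u a" for a
      using that by (auto simp: dup_reach_def)
    have "conv_below F R i (\<lambda>j. label_less F R j (?s, i e\<^sub>2)) ?u ?v"
      using wf_contracts_subst_update[OF xy wf(3)]
    proof (induction rule: rtranclp_induct)
      case (step a b)
      have "label_less F R (a, i e\<^sub>1) (?s, i e\<^sub>2)" using dup[OF reach[OF step(1)]] by (simp add: label_less_def)
      moreover have "labeled_step F R i (a, i e\<^sub>1) a b" by (rule labeled_stepI[OF assms(1) step(2)]) simp
      ultimately show ?case
        using step.IH unfolding conv_below_def by (auto intro: rtranclp.rtrancl_into_rtrancl)
    qed simp
    from conv_below_sym[OF this] t show ?thesis unfolding decreasing_join_def
      by (intro exI[of _ ?t] exI[of _ ?v]) auto
  qed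
qed

context
  fixes F :: "('f \<times> nat) set" and R :: "('f, 'v) trs" and i :: "('f, 'v) rule \<Rightarrow> nat"
  assumes infinite_vars: "infinite (UNIV :: 'v set)"
    and left_linear: "left_linear R"
    and diagrams: "\<And>e\<^sub>1 e\<^sub>2 t s u. critical_peak R e\<^sub>1 e\<^sub>2 t s u \<Longrightarrow>
           \<exists>D. local_diagram F R t D u \<and> fan_property F R s t D \<and>
               decreasing_diagram i (i e\<^sub>1) (i e\<^sub>2) D"
begin

lemma root_peak_decreasing_join:
  assumes "e\<^sub>1 \<in> R" "e\<^sub>2 \<in> R" "contracts e\<^sub>1 (fst e\<^sub>2 \<cdot> \<sigma>) t"
    and wf: "wf_term F (fst e\<^sub>2 \<cdot> \<sigma>)" "wf_term F t" "wf_term F (snd e\<^sub>2 \<cdot> \<sigma>)"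
  shows "decreasing_join F R i (fst e\<^sub>2 \<cdot> \<sigma>, i e\<^sub>1) (fst e\<^sub>2 \<cdot> \<sigma>, i e\<^sub>2) t (snd e\<^sub>2 \<cdot> \<sigma>)"
proof -
  have linear: "occs x (fst e\<^sub>2) \<le> 1" for x
    using left_linear assms(2) by (auto simp: left_linear_def)
  from contracts_subst_instance[OF assms(3) linear] show ?thesis
  proof (elim disjE exE conjE)
    fix p \<tau> assume p: "p \<in> fposs (fst e\<^sub>2)" "subt_at (fst e\<^sub>2) p \<cdot> \<sigma> = fst e\<^sub>1 \<cdot> \<tau>"
      and t: "t = replace_at (fst e\<^sub>2 \<cdot> \<sigma>) p (snd e\<^sub>1 \<cdot> \<tau>)"
    from critical_peak_instance[OF infinite_vars assms(1,2) p] obtain t' s' u' \<delta>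
      where peak: "critical_peak R e\<^sub>1 e\<^sub>2 t' s' u'" and inst: "s' \<cdot> \<delta> = fst e\<^sub>2 \<cdot> \<sigma>"
        "t' \<cdot> \<delta> = t" "u' \<cdot> \<delta> = snd e\<^sub>2 \<cdot> \<sigma>" unfolding t by blast
    from diagrams[OF peak] have join: "decreasing_join F R i (s', i e\<^sub>1) (s', i e\<^sub>2) t' u'"
      using local_diagram_decreasing_join by blast
    \<comment> \<open>\<open>\<delta>\<close> need not be well-formed on variables that occur only inside the diagram.\<close>
    let ?\<delta> = "\<lambda>x. if wf_term F (\<delta> x) then \<delta> x else Var x"
    have \<delta>: "a \<cdot> ?\<delta> = a \<cdot> \<delta>" if "wf_term F (a \<cdot> \<delta>)" for a
      using that by (intro subst_cong) (auto simp: wf_term_subst)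
    have "decreasing_join F R i (s' \<cdot> ?\<delta>, i e\<^sub>1) (s' \<cdot> ?\<delta>, i e\<^sub>2) (t' \<cdot> ?\<delta>) (u' \<cdot> ?\<delta>)"
      using decreasing_join_map[of F "\<lambda>a. a \<cdot> ?\<delta>", OF wf_contracts_subst[of F ?\<delta>] join] by simp
    then show ?thesis using \<delta> inst wf by simp
  next
    fix x y assume "x \<in> vars (fst e\<^sub>2)" "contracts e\<^sub>1 (\<sigma> x) y" "t = fst e\<^sub>2 \<cdot> \<sigma>(x := y)"
    then show ?thesis
      using variable_peak_decreasing_join[OF assms(1,2) linear] wf by blast
  qed
qed

text \<open>Either one of the steps is at the root, or both descend to arguments: to the same one,
  and then its diagram is lifted through the context, or to different ones, and then the steps
  commute.\<close>

lemma local_peak_decreasing_join: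
  assumes "e\<^sub>1 \<in> R" "e\<^sub>2 \<in> R" "wf_contracts F e\<^sub>1 s t" "wf_contracts F e\<^sub>2 s u"
  shows "decreasing_join F R i (s, i e\<^sub>1) (s, i e\<^sub>2) t u"
  using assms(3,4)
proof (induction s arbitrary: t u)
  case (Var x)
  \<comment> \<open>Left-hand sides may be variables, so a variable can be contracted; the step is
    then at the root.\<close>
  from Var(1) obtain \<sigma> where "Var x = fst e\<^sub>1 \<cdot> \<sigma>" "t = snd e\<^sub>1 \<cdot> \<sigma>"
    by (auto simp: wf_contracts_def elim: contracts.cases)
  with Var root_peak_decreasing_join[OF assms(2,1), of \<sigma> u] show ?case
    by (auto simp: wf_contracts_def intro: decreasing_join_sym)
next
  case (Fun f ss)
  have wf: "wf_term F (Fun f ss)" "wf_term F t" "wf_term F u"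
    using Fun.prems by (auto simp: wf_contracts_def)
  have c: "contracts e\<^sub>1 (Fun f ss) t" "contracts e\<^sub>2 (Fun f ss) u"
    using Fun.prems by (auto simp: wf_contracts_def)
  from c(1) consider \<sigma> where "Fun f ss = fst e\<^sub>1 \<cdot> \<sigma>" "t = snd e\<^sub>1 \<cdot> \<sigma>"
    | k t' where "k < length ss" "contracts e\<^sub>1 (ss ! k) t'" "t = Fun f (ss[k := t'])"
    by (cases rule: contracts.cases) auto
  note case1 = this
  from c(2) consider \<sigma> where "Fun f ss = fst e\<^sub>2 \<cdot> \<sigma>" "u = snd e\<^sub>2 \<cdot> \<sigma>"
    | j u' where "j < length ss" "contracts e\<^sub>2 (ss ! j) u'" "u = Fun f (ss[j := u'])"
    by (cases rule: contracts.cases) auto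
  then show ?case
  proof cases
    case (1 \<sigma>)
    with root_peak_decreasing_join[OF assms(1,2), of \<sigma> t] wf c show ?thesis by simp
  next
    case (2 j u')
    from case1 show ?thesis
    proof cases
      case (1 \<sigma>)
      with root_peak_decreasing_join[OF assms(2,1), of \<sigma> u] wf c show ?thesis
        by (auto intro: decreasing_join_sym)
    next
      case k: (2 k t')
      have nth: "wf_term F (ss ! k)" "wf_term F (ss ! j)" using wf(1) k(1) 2(1) by auto
      have "t' \<in> set (ss[k := t'])" "u' \<in> set (ss[j := u'])"
        using k(1) 2(1) by (auto intro: set_update_memI)
      then have "wf_term F t'" "wf_term F u'" using wf(2,3) k(3) 2(3) by auto
      with nth k(2) 2(2) have steps: "wf_contracts F e\<^sub>1 (ss ! k) t'" "wf_contracts F e\<^sub>2 (ss ! j) u'"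
        by (auto simp: wf_contracts_def)
      show ?thesis
      proof (cases "j = k")
        case True
        with Fun.IH[of "ss ! k" t' u'] steps k(1)
        have "decreasing_join F R i (ss ! k, i e\<^sub>1) (ss ! k, i e\<^sub>2) t' u'" by simp
        from decreasing_join_map[of F "\<lambda>a. Fun f (ss[k := a])", OF wf_contracts_arg[OF wf(1) k(1)] this]
        show ?thesis
          using True k(3) 2(3) by simp
      next
        case False
        let ?v = "Fun f (ss[k := t', j := u'])"
        have "wf_contracts F e\<^sub>2 (Fun f (ss[k := t', j := ss ! j])) ?v"
          using wf_contracts_arg[of F f "ss[k := t']" j, OF _ _ steps(2)] wf(2) k(3) 2(1) by simp
        then have tv: "wf_contracts F e\<^sub>2 t ?v"
          using False k(3) list_update_id[of "ss[k := t']" j] by simp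
        have "wf_contracts F e\<^sub>1 (Fun f (ss[j := u', k := ss ! k])) (Fun f (ss[j := u', k := t']))"
          using wf_contracts_arg[of F f "ss[j := u']" k, OF _ _ steps(1)] wf(3) k(1) 2(3) by simp
        then have uv: "wf_contracts F e\<^sub>1 u ?v"
          using False 2(3) list_update_id[of "ss[j := u']" k] list_update_swap[of k j ss t' u'] by simp
        \<comment> \<open>The commuted steps keep their indices and start at terms reachable from
          the source of the peak, so they may carry its labels and fill the two optional
          steps.\<close>
        have "(rstep F R)\<^sup>*\<^sup>* (Fun f ss) t" "(rstep F R)\<^sup>*\<^sup>* (Fun f ss) u"
          using Fun.prems assms(1,2) rstep_iff by blast+
        then show ?thesis unfolding decreasing_join_def
          using labeled_stepI[OF assms(2) tv] labeled_stepI[OF assms(1) uv]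
          by (intro exI[of _ t] exI[of _ ?v] exI[of _ u]) auto
      qed
    qed
  qed
qed

end

theorem theorem5p10:
  fixes F :: "('f \<times> nat) set" and R :: "('f, 'v) trs" and i :: "('f, 'v) rule \<Rightarrow> nat"
  assumes "infinite (UNIV :: 'v set)"
    and "trs_over F R"
    and "left_linear R"
    and "rel_terminating F (dup_rules R) (nondup_rules R)"
    and "\<And>e\<^sub>1 e\<^sub>2 t s u. critical_peak R e\<^sub>1 e\<^sub>2 t s u \<Longrightarrow>
           \<exists>D. local_diagram F R t D u \<and> fan_property F R s t D \<and>
               decreasing_diagram i (i e\<^sub>1) (i e\<^sub>2) D"
  shows "confluentp (rstep F R)"
proof -
  have "confluentp (\<lambda>s t. \<exists>l. labeled_step F R i l s t)"
  proof (rule decreasing_diagrams[OF wfp_label_less[OF assms(4)] transp_label_less])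
    fix k l s t u assume "labeled_step F R i k s t" "labeled_step F R i l s u"
    then obtain e\<^sub>1 e\<^sub>2 where e: "e\<^sub>1 \<in> R" "wf_contracts F e\<^sub>1 s t" "label_le F R (s, i e\<^sub>1) k"
      "e\<^sub>2 \<in> R" "wf_contracts F e\<^sub>2 s u" "label_le F R (s, i e\<^sub>2) l"
      unfolding labeled_step_def by blast
    have "decreasing_join F R i (s, i e\<^sub>1) (s, i e\<^sub>2) t u"
      by (rule local_peak_decreasing_join[OF assms(1,3,5) e(1,4,2,5)])
    from decreasing_join_mono[OF this e(3,6)]
    show "\<exists>y' y'' z'' z'.
       (\<lambda>x y. \<exists>\<gamma>. label_less F R \<gamma> k \<and> (labeled_step F R i \<gamma> x y \<or> labeled_step F R i \<gamma> y x))\<^sup>*\<^sup>* t y' \<and>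
       (labeled_step F R i l)\<^sup>=\<^sup>= y' y'' \<and>
       (\<lambda>x y. \<exists>\<gamma>. (label_less F R \<gamma> k \<or> label_less F R \<gamma> l) \<and>
          (labeled_step F R i \<gamma> x y \<or> labeled_step F R i \<gamma> y x))\<^sup>*\<^sup>* y'' z'' \<and>
       (labeled_step F R i k)\<^sup>=\<^sup>= z' z'' \<and>
       (\<lambda>x y. \<exists>\<gamma>. label_less F R \<gamma> l \<and> (labeled_step F R i \<gamma> x y \<or> labeled_step F R i \<gamma> y x))\<^sup>*\<^sup>* z' u"
      unfolding decreasing_join_def conv_below_def .
  qed
  \<comment> \<open>Every step carries at least its own label, so forgetting the labels loses no
    step.\<close>
  moreover have "(\<lambda>s t. \<exists>l. labeled_step F R i l s t) = rstep F R"
    by (intro ext) (auto simp: labeled_step_def rstep_iff label_le_def)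
  ultimately show ?thesis by simp
qed

end
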